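(* Let $f\colon X\to Y$ be a perfect $n$-dimensional map between metrizable spaces with $\dim Y=0$, and let $m\geq 2n+1$. Then the set of all maps $g\in C(X,\mathbb R^m)$ such that $\dim D_{2,1,m}(g|f^{-1}(y),z)\leq 0$ for all $y\in Y$ and all $z\in\mathbb R^m\setminus g(f^{-1}(y))$ is a dense $G_\delta$-subset of $C(X,\mathbb R^m)$ equipped with the source limitation topology.
   Context: All spaces are metrizable and all single-valued maps are continuous; $\dim$ is covering dimension. A perfect map is a closed continuous map with compact fibers; the map $f$ is $n$-dimensional if $\dim f=\sup\{\dim f^{-1}(y):y\in Y\}=n$. $C(X,\mathbb R^m)$ is the set of all continuous maps $X\to\mathbb R^m$. The source limitation topology on $C(X,M)$, for a metric space $(M,\rho)$, is the topology in which a neighborhood base at $h\in C(X,M)$ consists of the sets $B_\rho(h,\epsilon)=\{g\in C(X,M):\rho(g(x),h(x))<\epsilon(x)\ \text{for all}\ x\in X\}$, where $\epsilon\colon X\to(0,1]$ runs over all continuous positive functions. For a map $g$ from a space $Z$ into $\mathbb R^m$ and a point $z\notin g(Z)$, $D_{2,1,m}(g,z)$ is the subspace of $(\mathbb R^m)^2$ consisting of all points $(y_1,y_2)\in(\mathbb R^m)^2$ such that $y_1$ and $y_2$ belong to a line $\Pi^1\subset\mathbb R^m$ with $z\in\Pi^1$, and there exist two different points $x_1,x_2\in Z$ with $g(x_i)=y_i$, $i=1,2$. Here this is applied to the restriction $g|f^{-1}(y)\colon f^{-1}(y)\to\mathbb R^m$. *)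

theory Defs
  imports "HOL-Analysis.Analysis"
begin

section \<open>Covering dimension\<close>

text \<open>
  \<open>covering_dim_at_most X n\<close>: every finite open cover of \<open>X\<close> has a finite open refinement
  of order at most \<open>n\<close>, i.e. no point lies in more than \<open>n + 1\<close> of its members. The lower bound
  on \<open>n\<close> matters only for the empty space, whose dimension is \<open>-1\<close>.
\<close>

definition covering_dim_at_most :: "'a topology \<Rightarrow> int \<Rightarrow> bool" where
  "covering_dim_at_most X n \<longleftrightarrow>
     - 1 \<le> n \<and>
     (\<forall>\<U>. finite \<U> \<and> (\<forall>U\<in>\<U>. openin X U) \<and> \<Union>\<U> = topspace X \<longrightarrow>
        (\<exists>\<V>. finite \<V> \<and> (\<forall>V\<in>\<V>. openin X V) \<and> \<Union>\<V> = topspace X \<and>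
             (\<forall>V\<in>\<V>. \<exists>U\<in>\<U>. V \<subseteq> U) \<and>
             (\<forall>x\<in>topspace X. int (card {V\<in>\<V>. x \<in> V}) \<le> n + 1)))"

text \<open>The infimum over the empty set is \<open>\<infinity>\<close>, the value for infinite-dimensional spaces.\<close>

definition covering_dim :: "'a topology \<Rightarrow> ereal" where
  "covering_dim X = (INF n\<in>{n. covering_dim_at_most X n}. ereal (real_of_int n))"

lemma covering_dim_at_most_mono:
  assumes "covering_dim_at_most X k" "k \<le> n"
  shows "covering_dim_at_most X n"
  unfolding covering_dim_at_most_def
proof (intro conjI allI impI)
  show "- 1 \<le> n"
    using assms by (auto simp: covering_dim_at_most_def)
next
  fix \<U> assume \<U>: "finite \<U> \<and> (\<forall>U\<in>\<U>. openin X U) \<and> \<Union>\<U> = topspace X"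
  have "\<exists>\<V>. finite \<V> \<and> (\<forall>V\<in>\<V>. openin X V) \<and> \<Union>\<V> = topspace X \<and>
             (\<forall>V\<in>\<V>. \<exists>U\<in>\<U>. V \<subseteq> U) \<and>
             (\<forall>x\<in>topspace X. int (card {V\<in>\<V>. x \<in> V}) \<le> k + 1)"
    by (rule assms(1)[unfolded covering_dim_at_most_def, THEN conjunct2, rule_format, OF \<U>])
  moreover have "(\<forall>x\<in>topspace X. int (card {V\<in>\<V>. x \<in> V}) \<le> k + 1) \<longrightarrow>
      (\<forall>x\<in>topspace X. int (card {V\<in>\<V>. x \<in> V}) \<le> n + 1)" for \<V>
    using assms(2) by (meson add_le_cancel_right order_trans)
  ultimately show "\<exists>\<V>. finite \<V> \<and> (\<forall>V\<in>\<V>. openin X V) \<and> \<Union>\<V> = topspace X \<and>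
             (\<forall>V\<in>\<V>. \<exists>U\<in>\<U>. V \<subseteq> U) \<and>
             (\<forall>x\<in>topspace X. int (card {V\<in>\<V>. x \<in> V}) \<le> n + 1)"
    by (elim ex_forward) simp
qed

lemma covering_dim_le_iff:
  "covering_dim X \<le> ereal (real_of_int n) \<longleftrightarrow> covering_dim_at_most X n"
proof
  assume "covering_dim X \<le> ereal (real_of_int n)"
  then have "covering_dim X < ereal (real_of_int (n + 1))"
    by (rule order_le_less_trans) simp
  then obtain k where "covering_dim_at_most X k" "real_of_int k < real_of_int (n + 1)"
    unfolding covering_dim_def INF_less_iff by auto
  then show "covering_dim_at_most X n"
    using covering_dim_at_most_mono[of X k n] by linarith
next
  assume "covering_dim_at_most X n"
  then show "covering_dim X \<le> ereal (real_of_int n)"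
    unfolding covering_dim_def by (intro INF_lower) simp
qed

lemma covering_dim_le_neg1_iff: "covering_dim X \<le> - 1 \<longleftrightarrow> topspace X = {}"
proof -
  have "covering_dim_at_most X (-1) \<longleftrightarrow> topspace X = {}"
  proof
    assume "covering_dim_at_most X (-1)"
    then have "\<exists>\<V>. finite \<V> \<and> (\<forall>V\<in>\<V>. openin X V) \<and> \<Union>\<V> = topspace X \<and>
        (\<forall>V\<in>\<V>. \<exists>U\<in>{topspace X}. V \<subseteq> U) \<and>
        (\<forall>x\<in>topspace X. int (card {V\<in>\<V>. x \<in> V}) \<le> - 1 + 1)"
      unfolding covering_dim_at_most_def by (elim conjE allE[of _ "{topspace X}"]) simp
    then obtain \<V> where V: "finite \<V>" "\<Union>\<V> = topspace X"
        "\<And>x. x \<in> topspace X \<Longrightarrow> card {V\<in>\<V>. x \<in> V} = 0"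
      by auto
    have False if "x \<in> topspace X" for x
      using V(3)[OF that] V(1,2) that by auto
    then show "topspace X = {}"
      by blast
  next
    assume "topspace X = {}"
    then show "covering_dim_at_most X (-1)"
      unfolding covering_dim_at_most_def by (intro conjI allI impI exI[of _ "{}"]) simp_all
  qed
  then show ?thesis
    using covering_dim_le_iff[of X "-1"] by (simp add: one_ereal_def)
qed


section \<open>Fibers and the dimension of a map\<close>

definition fiber :: "'a topology \<Rightarrow> ('a \<Rightarrow> 'b) \<Rightarrow> 'b \<Rightarrow> 'a set" where
  "fiber X f y = {x \<in> topspace X. f x = y}"

definition map_dim :: "'a topology \<Rightarrow> 'b topology \<Rightarrow> ('a \<Rightarrow> 'b) \<Rightarrow> ereal" where
  "map_dim X Y f = (SUP y\<in>topspace Y. covering_dim (subtopology X (fiber X f y)))"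


section \<open>Function spaces with the source limitation topology\<close>

text \<open>
  Maps are normalised to be \<open>undefined\<close> off \<open>topspace X\<close>, so that equality of elements is
  equality of maps on \<open>X\<close>.
\<close>

definition cont_maps :: "'a topology \<Rightarrow> ('a \<Rightarrow> 'm::metric_space) set" where
  "cont_maps X = {g. continuous_map X euclidean g \<and> g \<in> extensional (topspace X)}"

definition sl_ball :: "'a topology \<Rightarrow> ('a \<Rightarrow> 'm::metric_space) \<Rightarrow> ('a \<Rightarrow> real) \<Rightarrow> ('a \<Rightarrow> 'm) set" where
  "sl_ball X h \<epsilon> = {g \<in> cont_maps X. \<forall>x\<in>topspace X. dist (g x) (h x) < \<epsilon> x}"

definition source_limitation_topology :: "'a topology \<Rightarrow> ('a \<Rightarrow> 'm::metric_space) topology" where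
  "source_limitation_topology X =
     topology (\<lambda>W. W \<subseteq> cont_maps X \<and>
       (\<forall>h\<in>W. \<exists>\<epsilon>. continuous_map X (top_of_set {0<..1}) \<epsilon> \<and> sl_ball X h \<epsilon> \<subseteq> W))"

lemma openin_source_limitation_topology:
  fixes X :: "'a topology" and W :: "('a \<Rightarrow> 'm::metric_space) set"
  shows "openin (source_limitation_topology X) W \<longleftrightarrow>
     W \<subseteq> cont_maps X \<and>
     (\<forall>h\<in>W. \<exists>\<epsilon>. continuous_map X (top_of_set {0<..1}) \<epsilon> \<and> sl_ball X h \<epsilon> \<subseteq> W)"
proof -
  let ?L = "\<lambda>W :: ('a \<Rightarrow> 'm) set. W \<subseteq> cont_maps X \<and>
     (\<forall>h\<in>W. \<exists>\<epsilon>. continuous_map X (top_of_set {0<..1}) \<epsilon> \<and> sl_ball X h \<epsilon> \<subseteq> W)"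
  have int: "?L (S \<inter> T)" if S: "?L S" and T: "?L T" for S T
  proof (intro conjI ballI)
    show "S \<inter> T \<subseteq> cont_maps X"
      using S by blast
  next
    fix h assume h: "h \<in> S \<inter> T"
    obtain a where a: "continuous_map X (top_of_set {0<..1}) a" "sl_ball X h a \<subseteq> S"
      using S h by blast
    obtain b where b: "continuous_map X (top_of_set {0<..1}) b" "sl_ball X h b \<subseteq> T"
      using T h by blast
    have "continuous_map X (top_of_set {0<..1}) (\<lambda>x. min (a x) (b x))"
      using continuous_map_real_min[of X a b] a(1) b(1)
      by (simp add: continuous_map_in_subtopology Pi_iff min_le_iff_disj)
    moreover have "sl_ball X h (\<lambda>x. min (a x) (b x)) \<subseteq> S \<inter> T"
      using a(2) b(2) by (auto simp: sl_ball_def)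
    ultimately show "\<exists>\<epsilon>. continuous_map X (top_of_set {0<..1}) \<epsilon> \<and> sl_ball X h \<epsilon> \<subseteq> S \<inter> T"
      by blast
  qed
  have un: "?L (\<Union>\<K>)" if K: "\<forall>W\<in>\<K>. ?L W" for \<K>
  proof (intro conjI ballI)
    show "\<Union>\<K> \<subseteq> cont_maps X"
      using K by blast
  next
    fix h assume "h \<in> \<Union>\<K>"
    then obtain W where W: "W \<in> \<K>" "h \<in> W"
      by blast
    then obtain \<epsilon> where "continuous_map X (top_of_set {0<..1}) \<epsilon>" "sl_ball X h \<epsilon> \<subseteq> W"
      using K by blast
    then show "\<exists>\<epsilon>. continuous_map X (top_of_set {0<..1}) \<epsilon> \<and> sl_ball X h \<epsilon> \<subseteq> \<Union>\<K>"
      using W(1) by blast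
  qed
  have "istopology ?L"
    unfolding istopology_def
    apply (rule conjI)
     apply (intro allI impI, rule int, assumption, assumption)
    apply (intro allI impI, rule un, assumption)
    done
  then show ?thesis
    unfolding source_limitation_topology_def by (simp only: topology_inverse')
qed

lemma topspace_source_limitation_topology [simp]:
  "topspace (source_limitation_topology X) = cont_maps X"
proof -
  have "continuous_map X (top_of_set {0<..1::real}) (\<lambda>_. 1)"
    by (simp add: continuous_map_in_subtopology)
  then have "openin (source_limitation_topology X) (cont_maps X)"
    unfolding openin_source_limitation_topology sl_ball_def by blast
  moreover have "topspace (source_limitation_topology X) \<subseteq> cont_maps X"
    using openin_source_limitation_topology openin_topspace by blast
  ultimately show ?thesis
    by (meson openin_subset subset_antisym)
qed

text \<open>The balls are open, hence form a neighborhood base at their centres.\<close>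

lemma openin_sl_ball:
  assumes h: "h \<in> cont_maps X" and e: "continuous_map X (top_of_set {0<..1}) \<epsilon>"
  shows "openin (source_limitation_topology X) (sl_ball X h \<epsilon>)"
  unfolding openin_source_limitation_topology
proof (intro conjI ballI)
  show "sl_ball X h \<epsilon> \<subseteq> cont_maps X"
    by (auto simp: sl_ball_def)
next
  fix g assume g: "g \<in> sl_ball X h \<epsilon>"
  let ?d = "\<lambda>x. \<epsilon> x - dist (g x) (h x)"
  have gh: "continuous_map X euclidean g" "continuous_map X euclidean h"
    using g h by (simp_all add: sl_ball_def cont_maps_def)
  have "continuous_map X euclidean (\<lambda>x. (g x, h x))"
    using continuous_map_pairedI[OF gh] by simp
  moreover have "continuous_map euclidean euclideanreal (\<lambda>p::'b \<times> 'b. dist (fst p) (snd p))"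
    by (auto intro!: continuous_on_dist continuous_on_fst continuous_on_snd continuous_on_id)
  ultimately have "continuous_map X euclideanreal ((\<lambda>p. dist (fst p) (snd p)) \<circ> (\<lambda>x. (g x, h x)))"
    by (rule continuous_map_compose)
  then have "continuous_map X euclideanreal (\<lambda>x. dist (g x) (h x))"
    by (simp add: o_def)
  moreover have "continuous_map X euclideanreal \<epsilon>" and e01: "\<forall>x\<in>topspace X. 0 < \<epsilon> x \<and> \<epsilon> x \<le> 1"
    using e by (auto simp: continuous_map_in_subtopology Pi_iff)
  ultimately have "continuous_map X euclideanreal ?d"
    by (intro continuous_map_diff)
  moreover have "0 < ?d x \<and> ?d x \<le> 1" if "x \<in> topspace X" for x
  proof -
    have "dist (g x) (h x) < \<epsilon> x" "\<epsilon> x \<le> 1" "0 \<le> dist (g x) (h x)"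
      using g e01 that by (simp_all add: sl_ball_def)
    then show ?thesis by linarith
  qed
  ultimately have "continuous_map X (top_of_set {0<..1}) ?d"
    by (simp add: continuous_map_in_subtopology Pi_iff)
  moreover have "sl_ball X g ?d \<subseteq> sl_ball X h \<epsilon>"
  proof
    fix k assume k: "k \<in> sl_ball X g ?d"
    have "dist (k x) (h x) < \<epsilon> x" if "x \<in> topspace X" for x
    proof -
      have "dist (k x) (g x) < \<epsilon> x - dist (g x) (h x)"
        using k that by (simp add: sl_ball_def)
      then show ?thesis
        using dist_triangle[of "k x" "h x" "g x"] by linarith
    qed
    then show "k \<in> sl_ball X h \<epsilon>"
      using k by (auto simp: sl_ball_def)
  qed
  ultimately show "\<exists>\<delta>. continuous_map X (top_of_set {0<..1}) \<delta> \<and> sl_ball X g \<delta> \<subseteq> sl_ball X h \<epsilon>"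
    by blast
qed


definition dense_gdelta_in :: "'a topology \<Rightarrow> 'a set \<Rightarrow> bool" where
  "dense_gdelta_in T S \<longleftrightarrow> gdelta_in T S \<and> T closure_of S = topspace T"


section \<open>Pairs of values on a line through a given point\<close>

text \<open>\<open>D21 Z g z\<close> is $D_{2,1,m}(g|Z, z)$, where $m$ is the cardinality of the index type.\<close>

definition D21 :: "'a set \<Rightarrow> ('a \<Rightarrow> real^'m) \<Rightarrow> real^'m \<Rightarrow> ((real^'m) \<times> (real^'m)) set" where
  "D21 Z g z =
     {(y1, y2). (\<exists>L. affine L \<and> aff_dim L = 1 \<and> z \<in> L \<and> y1 \<in> L \<and> y2 \<in> L) \<and>
        (\<exists>x1\<in>Z. \<exists>x2\<in>Z. x1 \<noteq> x2 \<and> g x1 = y1 \<and> g x2 = y2)}"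

end

theory Submission
  imports Defs
begin

text \<open>
  Call a compact set \<open>\<epsilon>\<close>-small if disjoint open sets of diameter below \<open>\<epsilon>\<close> cover it. For
  \<open>z \<notin> g(f\<^sup>-\<^sup>1(y))\<close> the set \<open>D\<close> of the theorem is the increasing union of the compact sets
  \<open>D\<^sub>k\<close> given by pairs \<open>(x\<^sub>1, x\<^sub>2)\<close> at distance at least \<open>1 / (k + 1)\<close>, so by the countable sum
  theorem \<open>dim D \<le> 0\<close> iff every \<open>D\<^sub>k\<close> is \<open>1 / (k + 1)\<close>-small. Since \<open>f\<close> is perfect, smallness of
  \<open>D\<^sub>k\<close> persists for nearby \<open>y\<close>, \<open>z\<close> and \<open>g\<close>, which gives a countable intersection of open sets.

  For density, map a neighbourhood of the fiber over \<open>y\<close> into \<open>\<real>\<^sup>m\<close> through the nerve of a fine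
  cover of order at most \<open>n + 1\<close>, with the vertices in general position near the values of the given
  map. Points that are far apart have carriers without a common vertex; as \<open>2n + 2 \<le> m + 1\<close>, two
  such carriers span a simplex, and through \<open>z\<close> there is at most one line meeting both. So \<open>D\<^sub>k\<close> is
  finite. As \<open>dim Y = 0\<close>, such local maps can be glued over a partition of \<open>Y\<close> into open sets, and
  the Baire property handles all \<open>k\<close> at once.
\<close>

section \<open>Zero-dimensional spaces\<close>

lemma zero_dim_refinement:
  assumes dim: "covering_dim_at_most X 0" and \<U>: "finite \<U>" "\<And>U. U \<in> \<U> \<Longrightarrow> openin X U" "\<Union>\<U> = topspace X"
  obtains \<V> where "finite \<V>" "\<And>V. V \<in> \<V> \<Longrightarrow> openin X V" "\<Union>\<V> = topspace X"
    "\<And>V. V \<in> \<V> \<Longrightarrow> \<exists>U\<in>\<U>. V \<subseteq> U" "pairwise disjnt \<V>"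
proof -
  obtain \<V> where V: "finite \<V>" "\<forall>V\<in>\<V>. openin X V" "\<Union>\<V> = topspace X" "\<forall>V\<in>\<V>. \<exists>U\<in>\<U>. V \<subseteq> U"
     and ord: "\<forall>x\<in>topspace X. int (card {V\<in>\<V>. x \<in> V}) \<le> 0 + 1"
    using dim[unfolded covering_dim_at_most_def, THEN conjunct2, rule_format, of \<U>] \<U> by auto
  have "V = W" if "V \<in> \<V>" "W \<in> \<V>" "x \<in> V" "x \<in> W" for V W x
  proof -
    have "card {V\<in>\<V>. x \<in> V} \<le> Suc 0" using ord V(3) that by force
    moreover have "finite {V\<in>\<V>. x \<in> V}" using V(1) by simp
    ultimately show ?thesis using that by (auto simp: card_le_Suc0_iff_eq)
  qed
  then have "pairwise disjnt \<V>" by (auto simp: pairwise_def disjnt_iff)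
  with V show ?thesis by (intro that[of \<V>]) auto
qed

text \<open>The complements of \<open>A\<close> and \<open>B\<close> form an open cover. In a
  disjoint open refinement a member meeting \<open>A\<close> must avoid \<open>B\<close>, and the
  union of these members is clopen because the others fill its complement.\<close>

lemma zero_dim_separation:
  assumes dim: "covering_dim_at_most X 0" and A: "closedin X A" and B: "closedin X B" and AB: "A \<inter> B = {}"
  obtains C where "openin X C" "closedin X C" "A \<subseteq> C" "C \<inter> B = {}"
proof -
  have AX: "A \<subseteq> topspace X" using A closedin_subset by blast
  obtain \<V> where V: "finite \<V>" "\<And>V. V \<in> \<V> \<Longrightarrow> openin X V" "\<Union>\<V> = topspace X"
    "\<And>V. V \<in> \<V> \<Longrightarrow> \<exists>U\<in>{topspace X - A, topspace X - B}. V \<subseteq> U" "pairwise disjnt \<V>"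
  proof (rule zero_dim_refinement[OF dim, of "{topspace X - A, topspace X - B}"])
    show "\<Union>{topspace X - A, topspace X - B} = topspace X" using AB by blast
    show "openin X U" if "U \<in> {topspace X - A, topspace X - B}" for U using that A B by blast
  qed simp_all
  let ?P = "{V\<in>\<V>. V \<inter> A \<noteq> {}}" and ?Q = "{V\<in>\<V>. V \<inter> A = {}}"
  have op: "openin X (\<Union>?P)" "openin X (\<Union>?Q)" using V(2) by (auto intro: openin_Union)
  have "\<Union>?P \<inter> \<Union>?Q = {}" 
  proof -
    have False if "V \<in> \<V>" "W \<in> \<V>" "V \<inter> A \<noteq> {}" "W \<inter> A = {}" "x \<in> V" "x \<in> W" for V W x
      using that V(5) unfolding pairwise_def disjnt_iff by metis
    then show ?thesis by blast
  qed
  moreover have "\<Union>?P \<union> \<Union>?Q = topspace X" unfolding V(3)[symmetric] by blast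
  ultimately have eq: "\<Union>?P = topspace X - \<Union>?Q" by blast
  have "closedin X (\<Union>?P)" unfolding eq using op(2) by blast
  moreover have "A \<subseteq> \<Union>?P" using AX V(3) by blast
  moreover have "\<Union>?P \<inter> B = {}" using V(4) by fastforce
  ultimately show ?thesis using that op by blast
qed

text \<open>Induction over the cover: a clopen set splits off a part inside one member and leaves a
  clopen remainder inside the union of the others.\<close>

lemma zero_dimI:
  assumes sep: "\<And>A B. closedin X A \<Longrightarrow> closedin X B \<Longrightarrow> A \<inter> B = {} \<Longrightarrow>
     \<exists>C. openin X C \<and> closedin X C \<and> A \<subseteq> C \<and> C \<inter> B = {}"
  shows "covering_dim_at_most X 0"
proof -
  have *: "\<exists>\<V>. finite \<V> \<and> (\<forall>V\<in>\<V>. openin X V) \<and> \<Union>\<V> = Z \<and> (\<forall>V\<in>\<V>. \<exists>U\<in>\<U>. V \<subseteq> U) \<and> pairwise disjnt \<V>"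
    if "finite \<U>" "\<forall>U\<in>\<U>. openin X U" "Z \<subseteq> \<Union>\<U>" "openin X Z" "closedin X Z" for \<U> Z
    using that
  proof (induction \<U> arbitrary: Z)
    case empty
    then show ?case by (intro exI[of _ "{}"]) auto
  next
    case (insert U \<U>)
    have "openin X (\<Union>\<U>)" "openin X U" using insert.prems by auto
    \<comment> \<open>These are the points of \<open>Z\<close> covered by \<open>U\<close> alone and
      the points outside \<open>U\<close>. A clopen \<open>C\<close> between them has
      \<open>Z \<inter> C\<close> inside \<open>U\<close> and \<open>Z - C\<close> inside the other
      members.\<close>
    then have "closedin X (Z - \<Union>\<U>)" "closedin X (Z - U)"
      using insert.prems by (auto intro: closedin_diff)
    moreover have "(Z - \<Union>\<U>) \<inter> (Z - U) = {}" using insert.prems by auto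
    ultimately obtain C where C: "openin X C" "closedin X C" "Z - \<Union>\<U> \<subseteq> C" "C \<inter> (Z - U) = {}"
      using sep[of "Z - \<Union>\<U>" "Z - U"] by blast
    have "\<exists>\<V>. finite \<V> \<and> (\<forall>V\<in>\<V>. openin X V) \<and> \<Union>\<V> = Z - C \<and> (\<forall>V\<in>\<V>. \<exists>U\<in>\<U>. V \<subseteq> U) \<and> pairwise disjnt \<V>"
      using insert.prems C by (intro insert.IH) (auto intro: openin_diff closedin_diff)
    then obtain \<V> where V: "finite \<V>" "\<forall>V\<in>\<V>. openin X V" "\<Union>\<V> = Z - C" "\<forall>V\<in>\<V>. \<exists>U\<in>\<U>. V \<subseteq> U" "pairwise disjnt \<V>"
      by (elim exE conjE)
    show ?case
    proof (intro exI[of _ "insert (Z \<inter> C) \<V>"] conjI)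
      show "finite (insert (Z \<inter> C) \<V>)" using V by simp
      show "\<forall>V\<in>insert (Z \<inter> C) \<V>. openin X V" using V C insert.prems by auto
      show "\<Union> (insert (Z \<inter> C) \<V>) = Z" using V(3) by auto
      show "\<forall>V\<in>insert (Z \<inter> C) \<V>. \<exists>U\<in>insert U \<U>. V \<subseteq> U" using V(4) C(4) by auto
      show "pairwise disjnt (insert (Z \<inter> C) \<V>)"
        using V(3,5) by (auto simp: pairwise_insert disjnt_iff)
    qed
  qed
  show ?thesis
    unfolding covering_dim_at_most_def
  proof (intro conjI allI impI)
    fix \<U> assume U: "finite \<U> \<and> (\<forall>U\<in>\<U>. openin X U) \<and> \<Union> \<U> = topspace X"
    then obtain \<V> where V: "finite \<V>" "\<forall>V\<in>\<V>. openin X V" "\<Union>\<V> = topspace X"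
        "\<forall>V\<in>\<V>. \<exists>U\<in>\<U>. V \<subseteq> U" "pairwise disjnt \<V>"
      using *[of \<U> "topspace X"] by auto
    have "card {V \<in> \<V>. x \<in> V} \<le> Suc 0" for x
      using V(1,5) by (subst card_le_Suc0_iff_eq) (auto simp: pairwise_def disjnt_iff)
    then have "int (card {V \<in> \<V>. x \<in> V}) \<le> 0 + 1" for x
      by (metis One_nat_def add_0 of_nat_1 of_nat_mono)
    then show "\<exists>\<V>. finite \<V> \<and> (\<forall>V\<in>\<V>. openin X V) \<and> \<Union> \<V> = topspace X \<and>
       (\<forall>V\<in>\<V>. \<exists>U\<in>\<U>. V \<subseteq> U) \<and> (\<forall>x\<in>topspace X. int (card {V \<in> \<V>. x \<in> V}) \<le> 0 + 1)"
      using V(1-4) by (intro exI[of _ \<V>]) simp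
  qed simp
qed

section \<open>Normality and the countable sum theorem in dimension zero\<close>

lemma normal_space_disjoint_closures:
  assumes "normal_space X" "closedin X A" "closedin X B" "A \<inter> B = {}"
  obtains U V where "openin X U" "openin X V" "A \<subseteq> U" "B \<subseteq> V" "X closure_of U \<inter> X closure_of V = {}"
proof -
  have alt: "\<And>S U. closedin X S \<Longrightarrow> openin X U \<Longrightarrow> S \<subseteq> U \<Longrightarrow> \<exists>V. openin X V \<and> S \<subseteq> V \<and> X closure_of V \<subseteq> U"
    using assms(1) unfolding normal_space_alt by blast
  have "openin X (topspace X - B)" "A \<subseteq> topspace X - B"
    using assms closedin_subset by (blast, fastforce)
  then obtain U where U: "openin X U" "A \<subseteq> U" "X closure_of U \<subseteq> topspace X - B"
    using alt assms(2,3) by metis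
  have "openin X (topspace X - X closure_of U)" "B \<subseteq> topspace X - X closure_of U"
    using U assms closedin_subset by fastforce+
  then obtain V where V: "openin X V" "B \<subseteq> V" "X closure_of V \<subseteq> topspace X - X closure_of U"
    using alt assms(2,3) by metis
  show ?thesis using that[OF U(1) V(1) U(2) V(2)] V(3) by blast
qed

text \<open>The two closed sets grow through open sets with disjoint closures, and step
  \<open>k\<close> distributes \<open>D k\<close> between the two sides. The unions are open,
  disjoint and cover the space, hence clopen.\<close>

lemma zero_dim_countable_sum:
  assumes nX: "normal_space X" and D: "\<And>k::nat. closedin X (D k)" "(\<Union>k. D k) = topspace X"
    and dim: "\<And>k. covering_dim_at_most (subtopology X (D k)) 0"
  shows "covering_dim_at_most X 0"
proof (rule zero_dimI)
  fix A B assume A: "closedin X A" and B: "closedin X B" and AB: "A \<inter> B = {}"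
  \<comment> \<open>Disjoint closures, not merely disjoint sets: the closures are the closed sets
    fed into the next step.\<close>
  define good where "good = (\<lambda>(U,V). openin X U \<and> openin X V \<and> X closure_of U \<inter> X closure_of V = {})"
  have step: "\<exists>W. good W \<and> S \<subseteq> fst W \<and> T \<subseteq> snd W \<and> D k \<subseteq> fst W \<union> snd W"
    if ST: "closedin X S" "closedin X T" "S \<inter> T = {}" for S T k
  proof -
    have cl: "closedin (subtopology X (D k)) (S \<inter> D k)" "closedin (subtopology X (D k)) (T \<inter> D k)"
      using ST by (auto simp: closedin_subtopology)
    have dj: "(S \<inter> D k) \<inter> (T \<inter> D k) = {}" using ST by blast
    \<comment> \<open>\<open>C\<close> and \<open>D k - C\<close> are closed in \<open>X\<close>
      because \<open>D k\<close> is, so they can be joined to \<open>S\<close> and \<open>T\<close>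
      before normality is applied.\<close>
    obtain C where C: "openin (subtopology X (D k)) C" "closedin (subtopology X (D k)) C" "S \<inter> D k \<subseteq> C" "C \<inter> (T \<inter> D k) = {}"
      using zero_dim_separation[OF dim cl dj] by metis
    have DX: "D k \<subseteq> topspace X" using D(1) closedin_subset by blast
    have CX: "closedin X C" using C(2) D(1) closedin_trans_full by blast
    have "closedin (subtopology X (D k)) (topspace (subtopology X (D k)) - C)" using C(1) by blast
    then have CX': "closedin X (D k - C)" using DX closedin_trans_full[OF _ D(1)] by (simp add: inf.absorb2)
    have CD: "C \<subseteq> D k" using C(2) closedin_subset by fastforce
    have dj': "(S \<union> C) \<inter> (T \<union> (D k - C)) = {}" using ST(3) C(3,4) CD by blast
    obtain U V where "openin X U" "openin X V" "S \<union> C \<subseteq> U" "T \<union> (D k - C) \<subseteq> V" "X closure_of U \<inter> X closure_of V = {}"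
      by (rule normal_space_disjoint_closures[OF nX closedin_Un[OF ST(1) CX] closedin_Un[OF ST(2) CX'] dj'])
    then show ?thesis unfolding good_def by (intro exI[of _ "(U,V)"]) auto
  qed
  have "\<exists>F. \<forall>k. (good (F k) \<and> A \<subseteq> fst (F k) \<and> B \<subseteq> snd (F k)) \<and>
      (fst (F k) \<subseteq> fst (F (Suc k)) \<and> snd (F k) \<subseteq> snd (F (Suc k)) \<and> D k \<subseteq> fst (F (Suc k)) \<union> snd (F (Suc k)))"
  proof (rule dependent_nat_choice)
    show "\<exists>x. good x \<and> A \<subseteq> fst x \<and> B \<subseteq> snd x" using step[OF A B AB] by blast
  next
    fix W k assume W: "good W \<and> A \<subseteq> fst W \<and> B \<subseteq> snd W"
    have "X closure_of (fst W) \<inter> X closure_of (snd W) = {}" using W by (auto simp: good_def split: prod.splits)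
    from step[OF closedin_closure_of closedin_closure_of this, of k]
    obtain W' where W': "good W'" "X closure_of (fst W) \<subseteq> fst W'" "X closure_of (snd W) \<subseteq> snd W'" "D k \<subseteq> fst W' \<union> snd W'"
      by blast
    have "fst W \<subseteq> X closure_of (fst W)" "snd W \<subseteq> X closure_of (snd W)"
      using W by (auto simp: good_def split: prod.splits intro!: closure_of_subset dest: openin_subset)
    then show "\<exists>y. (good y \<and> A \<subseteq> fst y \<and> B \<subseteq> snd y) \<and> (fst W \<subseteq> fst y \<and> snd W \<subseteq> snd y \<and> D k \<subseteq> fst y \<union> snd y)"
      using W W' by (intro exI[of _ W']) blast
  qed
  then obtain F where F: "\<And>k. good (F k)" "\<And>k. A \<subseteq> fst (F k)" "\<And>k. B \<subseteq> snd (F k)" 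
    "\<And>k. fst (F k) \<subseteq> fst (F (Suc k))" "\<And>k. snd (F k) \<subseteq> snd (F (Suc k))" "\<And>k. D k \<subseteq> fst (F (Suc k)) \<union> snd (F (Suc k))"
    by metis
  let ?U = "\<Union>k. fst (F k)" and ?V = "\<Union>k. snd (F k)"
  have F0: "openin X (fst (F k))" "openin X (snd (F k))" "fst (F k) \<inter> snd (F k) = {}" for k
  proof -
    show o: "openin X (fst (F k))" "openin X (snd (F k))"
      using F(1)[of k] by (auto simp: good_def split: prod.splits)
    then have "fst (F k) \<subseteq> X closure_of (fst (F k))" "snd (F k) \<subseteq> X closure_of (snd (F k))"
      by (simp_all add: closure_of_subset openin_subset)
    then show "fst (F k) \<inter> snd (F k) = {}" using F(1)[of k] by (auto simp: good_def split: prod.splits)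
  qed
  have op: "openin X ?U" "openin X ?V" using F0 by auto
  have mono: "fst (F i) \<subseteq> fst (F j)" "snd (F i) \<subseteq> snd (F j)" if "i \<le> j" for i j
    using F(4,5) lift_Suc_mono_le[of "\<lambda>k. fst (F k)"] lift_Suc_mono_le[of "\<lambda>k. snd (F k)"] that by auto
  have "?U \<inter> ?V = {}"
  proof -
    have False if "x \<in> fst (F i)" "x \<in> snd (F j)" for x i j
      using mono(1)[of i "max i j"] mono(2)[of j "max i j"] F0(3)[of "max i j"] that by auto
    then show ?thesis by blast
  qed
  moreover have "?U \<union> ?V = topspace X"
  proof
    show "?U \<union> ?V \<subseteq> topspace X" using op openin_subset by blast
    show "topspace X \<subseteq> ?U \<union> ?V" using F(6) unfolding D(2)[symmetric] by blast
  qed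
  ultimately have eq: "?U = topspace X - ?V" by blast
  have "closedin X ?U" unfolding eq using op(2) by blast
  moreover have "A \<subseteq> ?U" "B \<subseteq> ?V" using F(2,3) by blast+
  ultimately show "\<exists>C. openin X C \<and> closedin X C \<and> A \<subseteq> C \<and> C \<inter> B = {}"
    using op \<open>?U \<inter> ?V = {}\<close> by (intro exI[of _ ?U]) blast
qed

section \<open>Tools for metric spaces\<close>

context Metric_space
begin

text \<open>Meant to extend a relatively open subset \<open>V\<close> of \<open>K\<close> to an open
  set of the space: balls of radius \<open>s / 2\<close> about points \<open>q\<close> of
  \<open>V\<close> whose \<open>s\<close>-ball meets \<open>K\<close> only in \<open>V\<close>. The
  factor one half ensures that thickenings meet only where the sets themselves do, so the order of a
  cover is preserved.\<close>

definition thicken :: "'a set \<Rightarrow> 'a set \<Rightarrow> 'a set" where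
  "thicken K V = {p \<in> M. \<exists>q\<in>V \<inter> M. \<exists>s. d p q < s / 2 \<and> (\<forall>x\<in>K \<inter> M. d q x < s \<longrightarrow> x \<in> V)}"

lemma openin_thicken: "openin mtopology (thicken K V)"
  unfolding openin_mtopology
proof (intro conjI allI impI)
  fix p assume "p \<in> thicken K V"
  then obtain q s where p: "p \<in> M" "q \<in> V \<inter> M" "d p q < s / 2" "\<forall>x\<in>K \<inter> M. d q x < s \<longrightarrow> x \<in> V"
    unfolding thicken_def by blast
  have "mball p (s / 2 - d p q) \<subseteq> thicken K V"
  proof
    fix x assume x: "x \<in> mball p (s / 2 - d p q)"
    then have "d x q < s / 2" using p triangle[of x p q] commute[of x p] by auto
    moreover have "x \<in> M" using x by simp
    ultimately show "x \<in> thicken K V" using p(2,4) unfolding thicken_def by (intro CollectI conjI bexI[of _ q] exI[of _ s])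
  qed
  then show "\<exists>r>0. mball p r \<subseteq> thicken K V" using p by (intro exI[of _ "s / 2 - d p q"]) auto
qed (auto simp: thicken_def)

lemma subset_thicken:
  assumes "openin (subtopology mtopology K) V"
  shows "V \<subseteq> thicken K V"
proof
  fix q assume q: "q \<in> V"
  obtain T where T: "openin mtopology T" "V = T \<inter> K" using assms by (auto simp: openin_subtopology)
  then obtain r where r: "r > 0" "mball q r \<subseteq> T" "q \<in> M" 
    using q unfolding openin_mtopology by blast
  then have "\<forall>x\<in>K \<inter> M. d q x < r \<longrightarrow> x \<in> V" using T by auto
  then show "q \<in> thicken K V" unfolding thicken_def using q r by (intro CollectI conjI bexI[of _ q] exI[of _ r]) auto
qed

text \<open>If \<open>p\<close> lies in the thickenings of \<open>V\<^sub>1, \<dots>, V\<^sub>k\<close> with witnesses \<open>(q\<^sub>i, s\<^sub>i)\<close>, then the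
  \<open>q\<^sub>i\<close> with the smallest \<open>s\<^sub>i\<close> lies in every \<open>V\<^sub>j\<close>.\<close>

lemma thicken_common_point:
  assumes fin: "finite \<W>" "\<W> \<noteq> {}" and p: "\<And>V. V \<in> \<W> \<Longrightarrow> p \<in> thicken K V" and K: "\<And>V. V \<in> \<W> \<Longrightarrow> V \<subseteq> K"
  obtains q where "q \<in> K" "\<And>V. V \<in> \<W> \<Longrightarrow> q \<in> V"
proof -
  have "\<forall>V\<in>\<W>. \<exists>q s. p \<in> M \<and> q \<in> V \<inter> M \<and> d p q < s / 2 \<and> (\<forall>x\<in>K \<inter> M. d q x < s \<longrightarrow> x \<in> V)"
    using p unfolding thicken_def by blast
  then obtain q s where qs: "\<And>V. V \<in> \<W> \<Longrightarrow> p \<in> M \<and> q V \<in> V \<inter> M \<and> d p (q V) < s V / 2 \<and> (\<forall>x\<in>K \<inter> M. d (q V) x < s V \<longrightarrow> x \<in> V)"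
    by metis
  obtain W where W: "W \<in> \<W>" "\<And>V. V \<in> \<W> \<Longrightarrow> s W \<le> s V"
    using ex_min_if_finite[of "s ` \<W>"] fin by (metis (no_types, lifting) arg_min_if_finite(1) arg_min_least)
  show ?thesis
  proof (rule that)
    show "q W \<in> K" using qs[OF W(1)] K[OF W(1)] by blast
    fix V assume V: "V \<in> \<W>"
    have "d (q V) (q W) \<le> d p (q V) + d p (q W)"
      using triangle''[of "q V" p "q W"] qs[OF V] qs[OF W(1)] by auto
    also have "\<dots> < s V" using qs[OF V] qs[OF W(1)] W(2)[OF V] by linarith
    finally show "q W \<in> V" using qs[OF V] qs[OF W(1)] K[OF W(1)] by blast
  qed
qed

text \<open>The supremum of the radii with property \<open>R\<close>, cut off at 1 to keep it
  finite. It serves both for balls inside an open set and for the stable radii of a map.\<close>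

definition radius :: "('a \<Rightarrow> real \<Rightarrow> bool) \<Rightarrow> 'a \<Rightarrow> real" where
  "radius R x = Sup {r. 0 \<le> r \<and> r \<le> 1 \<and> R x r}"

lemma radius_upper: "0 \<le> r \<Longrightarrow> r \<le> 1 \<Longrightarrow> R x r \<Longrightarrow> r \<le> radius R x"
  unfolding radius_def by (intro cSup_upper) (auto intro!: bdd_aboveI[of _ 1])

lemma radius_le:
  assumes "R x 0" "\<And>r. 0 \<le> r \<Longrightarrow> r \<le> 1 \<Longrightarrow> R x r \<Longrightarrow> r \<le> c"
  shows "radius R x \<le> c"
  unfolding radius_def
proof (rule cSup_least)
  show "{r. 0 \<le> r \<and> r \<le> 1 \<and> R x r} \<noteq> {}" using assms(1) by (auto intro!: exI[of _ 0])
qed (use assms(2) in auto)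

lemma radius_nonneg: "R x 0 \<Longrightarrow> 0 \<le> radius R x"
  by (rule radius_upper) auto

lemma radius_le_1: "R x 0 \<Longrightarrow> radius R x \<le> 1"
  by (rule radius_le) auto

lemma radius_greater:
  assumes "R x 0" "c < radius R x"
  obtains r where "0 \<le> r" "r \<le> 1" "R x r" "c < r"
  using assms radius_le[of R x c] by (meson not_le)

lemma radius_lipschitz:
  assumes R0: "\<And>x. x \<in> M \<Longrightarrow> R x 0"
    and R: "\<And>x y r. x \<in> M \<Longrightarrow> y \<in> M \<Longrightarrow> R x r \<Longrightarrow> d x y \<le> r \<Longrightarrow> R y (r - d x y)"
    and x: "x \<in> M" and y: "y \<in> M"
  shows "radius R x \<le> radius R y + d x y"
proof (rule radius_le)
  show "R x 0" using R0 x by blast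
  fix r assume r: "0 \<le> r" "r \<le> 1" "R x r"
  show "r \<le> radius R y + d x y"
  proof (cases "d x y \<le> r")
    case True
    then have "r - d x y \<le> radius R y" using r R[OF x y r(3)] nonneg[of x y]
      by (intro radius_upper) linarith+
    then show ?thesis by linarith
  next
    case False
    then show ?thesis using radius_nonneg[of R y] R0[OF y] by linarith
  qed
qed

lemma continuous_map_radius:
  assumes R0: "\<And>x. x \<in> M \<Longrightarrow> R x 0"
    and R: "\<And>x y r. x \<in> M \<Longrightarrow> y \<in> M \<Longrightarrow> R x r \<Longrightarrow> d x y \<le> r \<Longrightarrow> R y (r - d x y)"
  shows "continuous_map mtopology euclideanreal (radius R)"
proof -
  have "\<exists>\<delta>>0. \<forall>x. x \<in> M \<and> d a x < \<delta> \<longrightarrow> dist (radius R a) (radius R x) < \<epsilon>" if "a \<in> M" "\<epsilon> > 0" for a \<epsilon>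
  proof (intro exI[of _ \<epsilon>] conjI allI impI)
    fix x assume x: "x \<in> M \<and> d a x < \<epsilon>"
    then show "dist (radius R a) (radius R x) < \<epsilon>"
      using radius_lipschitz[of R a x, OF R0 R] radius_lipschitz[of R x a, OF R0 R] that commute[of x a]
      by (simp add: dist_real_def abs_less_iff)
  qed (use that in auto)
  then have "continuous_map mtopology Met_TC.mtopology (radius R)"
    using metric_continuous_map[OF Met_TC.Metric_space_axioms, of "radius R"] by simp
  then show ?thesis by simp
qed

text \<open>The supremal radius of a ball inside \<open>V\<close> is a cut-off distance to the
  complement. Off \<open>M\<close> balls are empty, so its sign carries information only on
  \<open>M\<close>.\<close>

lemma openin_cozero:
  assumes V: "openin mtopology V"
  obtains \<phi> where "continuous_map mtopology euclideanreal \<phi>" "\<And>x. 0 \<le> \<phi> x" "\<And>x. x \<in> M \<Longrightarrow> 0 < \<phi> x \<longleftrightarrow> x \<in> V"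
proof -
  let ?R = "\<lambda>x r. mball x r \<subseteq> V"
  have R0: "?R x 0" for x using mball_eq_empty[of x 0] by auto
  show ?thesis
  proof
    show "continuous_map mtopology euclideanreal (radius ?R)"
    proof (rule continuous_map_radius)
      fix x y r assume "x \<in> M" "y \<in> M" "mball x r \<subseteq> V"
      moreover have "mball y (r - d x y) \<subseteq> mball x r" using \<open>x \<in> M\<close> 
        by (intro mball_subset) (simp_all add: commute)
      ultimately show "mball y (r - d x y) \<subseteq> V" by blast
    qed (rule R0)
    show "0 \<le> radius ?R x" for x using radius_nonneg[of ?R x] R0 by simp
    show "0 < radius ?R x \<longleftrightarrow> x \<in> V" if x: "x \<in> M" for x
    proof
      assume "0 < radius ?R x"
      then obtain r where "0 < r" "mball x r \<subseteq> V" using radius_greater[of ?R x 0] R0 by metis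
      then show "x \<in> V" using x by auto
    next
      assume "x \<in> V"
      then obtain r where r: "0 < r" "mball x r \<subseteq> V" using V unfolding openin_mtopology by blast
      have "mball x (min r 1) \<subseteq> V" using r by auto
      then have "min r 1 \<le> radius ?R x" using r by (intro radius_upper) auto
      then show "0 < radius ?R x" using r by auto
    qed
  qed
qed

end

section \<open>Disjoint open covers of small diameter as a test for dimension zero\<close>

definition small_pieces :: "real \<Rightarrow> 'a::metric_space set \<Rightarrow> bool" where
  "small_pieces \<epsilon> K \<longleftrightarrow> (\<exists>\<V>. (\<forall>V\<in>\<V>. open V \<and> (\<forall>p\<in>V. \<forall>q\<in>V. dist p q < \<epsilon>)) \<and> pairwise disjnt \<V> \<and> K \<subseteq> \<Union>\<V>)"

lemma small_pieces_mono: "small_pieces \<epsilon> K \<Longrightarrow> L \<subseteq> K \<Longrightarrow> \<epsilon> \<le> \<delta> \<Longrightarrow> small_pieces \<delta> L"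
  unfolding small_pieces_def by (elim exE, rule_tac x=\<V> in exI) force

text \<open>Openness in the whole space is what lets a cover persist for nearby sets. Relatively
  open pieces are therefore thickened; the thickenings stay disjoint, since a common point of two of
  them forces one of the pieces, and balls of radius \<open>\<epsilon> / 2\<close> keep them
  small.\<close>

lemma small_piecesI:
  fixes K :: "'a::metric_space set"
  assumes V: "\<And>V. V \<in> \<V> \<Longrightarrow> openin (top_of_set K) V" and disj: "pairwise disjnt \<V>" and cov: "K \<subseteq> \<Union>\<V>"
    and small: "\<And>V. V \<in> \<V> \<Longrightarrow> \<exists>c. V \<subseteq> ball c (\<epsilon> / 2)"
  shows "small_pieces \<epsilon> K"
proof -
  obtain c where c: "\<And>V. V \<in> \<V> \<Longrightarrow> V \<subseteq> ball (c V) (\<epsilon> / 2)" using small by metis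
  define E where "E V = Met_TC.thicken K V \<inter> ball (c V) (\<epsilon> / 2)" for V
  have "\<forall>W\<in>E ` \<V>. open W \<and> (\<forall>p\<in>W. \<forall>q\<in>W. dist p q < \<epsilon>)"
  proof
    fix W assume "W \<in> E ` \<V>"
    then obtain V where W: "W = E V" "V \<in> \<V>" by blast
    have "open (Met_TC.thicken K V)" using Met_TC.openin_thicken[of K V] by simp
    then have "open W" by (auto simp: W E_def)
    moreover have "dist p q < \<epsilon>" if "p \<in> W" "q \<in> W" for p q
      using that dist_triangle_half_r[of "c V" p \<epsilon> q] unfolding W E_def by simp
    ultimately show "open W \<and> (\<forall>p\<in>W. \<forall>q\<in>W. dist p q < \<epsilon>)" by blast
  qed
  moreover have "pairwise disjnt (E ` \<V>)"
  proof (rule pairwiseI)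
    fix A B assume "A \<in> E ` \<V>" "B \<in> E ` \<V>" "A \<noteq> B"
    then obtain V W where VW: "V \<in> \<V>" "W \<in> \<V>" "A = E V" "B = E W" "V \<noteq> W" by blast
    have "disjnt V W" using disj VW by (simp add: pairwise_def)
    have False if p: "p \<in> A" "p \<in> B" for p
    proof -
      have VK: "V \<subseteq> K" "W \<subseteq> K" using V VW by (auto dest: openin_imp_subset)
      have "p \<in> Met_TC.thicken K V" "p \<in> Met_TC.thicken K W" using p VW by (simp_all add: E_def)
      then obtain q where "\<And>U. U \<in> {V, W} \<Longrightarrow> q \<in> U"
        using Met_TC.thicken_common_point[of "{V, W}" p K thesis] VK by blast
      then have "q \<in> V" "q \<in> W" by simp_all
      then show False using \<open>disjnt V W\<close> by (simp add: disjnt_iff)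
    qed
    then show "disjnt A B" by (auto simp: disjnt_iff)
  qed
  moreover have "K \<subseteq> \<Union>(E ` \<V>)"
  proof
    fix x assume "x \<in> K"
    then obtain V where "V \<in> \<V>" "x \<in> V" using cov by blast
    moreover have "V \<subseteq> Met_TC.thicken K V" using Met_TC.subset_thicken[of K V] V[OF \<open>V \<in> \<V>\<close>] by simp
    ultimately show "x \<in> \<Union>(E ` \<V>)" using c[OF \<open>V \<in> \<V>\<close>] unfolding E_def by blast
  qed
  ultimately show ?thesis unfolding small_pieces_def by (intro exI[of _ "E ` \<V>"] conjI)
qed

text \<open>The closure of the bounded set \<open>D\<close> is compact, which yields the finite
  cover by balls that the definition of dimension asks for; \<open>D\<close> itself may fail to be
  closed.\<close>

lemma zero_dim_imp_small_pieces:
  fixes D :: "'a::euclidean_space set"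
  assumes dim: "covering_dim_at_most (top_of_set D) 0" and D: "bounded D" and \<epsilon>: "0 < \<epsilon>"
  shows "small_pieces \<epsilon> D"
proof -
  have "compact (closure D)" using D by (simp add: compact_closure)
  then obtain C where C: "finite C" "closure D \<subseteq> (\<Union>c\<in>C. ball c (\<epsilon> / 2))"
    using \<epsilon> compact_eq_totally_bounded[of "closure D"] by (metis half_gt_zero)
  let ?\<U> = "(\<lambda>c. D \<inter> ball c (\<epsilon> / 2)) ` C"
  have cov: "\<Union>?\<U> = topspace (top_of_set D)" using C(2) closure_subset[of D] by auto
  have op: "\<And>U. U \<in> ?\<U> \<Longrightarrow> openin (top_of_set D) U" by (auto intro: openin_open_Int)
  obtain \<V> where V: "finite \<V>" "\<And>V. V \<in> \<V> \<Longrightarrow> openin (top_of_set D) V" "\<Union>\<V> = topspace (top_of_set D)"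
    "\<And>V. V \<in> \<V> \<Longrightarrow> \<exists>U\<in>?\<U>. V \<subseteq> U" "pairwise disjnt \<V>"
    using zero_dim_refinement[OF dim finite_imageI[OF C(1)] op cov] by metis
  show ?thesis
    using V(2,5)
  proof (rule small_piecesI)
    show "D \<subseteq> \<Union>\<V>" using V(3) by simp
    show "\<exists>c. V \<subseteq> ball c (\<epsilon> / 2)" if "V \<in> \<V>" for V using V(4)[OF that] by blast
  qed
qed

lemma finite_imp_small_pieces:
  assumes "finite K" "0 < \<epsilon>"
  shows "small_pieces \<epsilon> K"
proof (rule small_piecesI[of "(\<lambda>x. {x}) ` K"])
  show "openin (top_of_set K) V" if V: "V \<in> (\<lambda>x. {x}) ` K" for V
  proof -
    have "open (- (K - V))" using assms by (intro open_Compl finite_imp_closed) simp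
    moreover have "V = K \<inter> - (K - V)" using V by auto
    ultimately show ?thesis by (metis openin_open_Int)
  qed
  show "\<exists>c. V \<subseteq> ball c (\<epsilon> / 2)" if V: "V \<in> (\<lambda>x. {x}) ` K" for V
  proof -
    obtain x where "V = {x}" using V by blast
    then show ?thesis using assms by (intro exI[of _ x]) simp
  qed
qed (auto simp: pairwise_def)

text \<open>Disjoint closed subsets of a compact set have positive distance \<open>\<delta>\<close>.
  No piece with distances below \<open>\<delta>\<close> meets both, so the pieces meeting
  \<open>A\<close> give the clopen separator.\<close>

lemma small_pieces_imp_zero_dim:
  fixes K :: "'a::heine_borel set"
  assumes K: "compact K" and small_pieces: "\<And>\<epsilon>. 0 < \<epsilon> \<Longrightarrow> small_pieces \<epsilon> K"
  shows "covering_dim_at_most (top_of_set K) 0"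
proof (rule zero_dimI)
  fix A B assume A: "closedin (top_of_set K) A" and B: "closedin (top_of_set K) B" and AB: "A \<inter> B = {}"
  have "compact A" "compact B" using A B K closedin_compact by blast+
  then obtain \<delta> where \<delta>: "\<delta> > 0" "\<And>x y. x \<in> A \<Longrightarrow> y \<in> B \<Longrightarrow> \<delta> \<le> dist x y"
    using separate_compact_closed[of A B] AB compact_imp_closed by blast
  obtain \<V> where V: "\<And>V. V \<in> \<V> \<Longrightarrow> open V" "\<And>V p q. V \<in> \<V> \<Longrightarrow> p \<in> V \<Longrightarrow> q \<in> V \<Longrightarrow> dist p q < \<delta>"
     "pairwise disjnt \<V>" "K \<subseteq> \<Union>\<V>"
    using small_pieces[OF \<delta>(1)] unfolding small_pieces_def by auto
  define P where "P = \<Union>{V\<in>\<V>. V \<inter> A \<noteq> {}}"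
  define Q where "Q = \<Union>{V\<in>\<V>. V \<inter> A = {}}"
  have op: "open P" "open Q" using V(1) by (auto simp: P_def Q_def)
  have PQ: "P \<inter> Q = {}" 
  proof -
    have False if "V \<in> \<V>" "W \<in> \<V>" "V \<inter> A \<noteq> {}" "W \<inter> A = {}" "x \<in> V" "x \<in> W" for V W x
      using that V(3) unfolding pairwise_def disjnt_iff by metis
    then show ?thesis unfolding P_def Q_def by blast
  qed
  have "\<Union>\<V> \<subseteq> P \<union> Q" unfolding P_def Q_def by blast
  then have KPQ: "K \<subseteq> P \<union> Q" using V(4) by order
  have "K \<inter> P = K - Q" using PQ KPQ by blast
  then have "closedin (top_of_set K) (K \<inter> P)"
    using op(2) closedin_closed_Int[of "- Q" K] by (simp add: Diff_eq closed_Compl)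
  moreover have "openin (top_of_set K) (K \<inter> P)" using op(1) by (rule openin_open_Int)
  moreover have AK: "A \<subseteq> K" using A by (rule closedin_imp_subset)
  moreover have "A \<subseteq> P" using KPQ AK unfolding Q_def by blast
  moreover have "P \<inter> B = {}"
  proof -
    have False if "V \<in> \<V>" "a \<in> V" "a \<in> A" "b \<in> V" "b \<in> B" for V a b
      using V(2)[of V a b] \<delta>(2)[of a b] that by linarith
    then show ?thesis unfolding P_def by blast
  qed
  ultimately show "\<exists>C. openin (top_of_set K) C \<and> closedin (top_of_set K) C \<and> A \<subseteq> C \<and> C \<inter> B = {}"
    by (intro exI[of _ "K \<inter> P"]) blast
qed

section \<open>Disjoint open refinements of arbitrary open covers in dimension zero\<close>

context Metric_space
begin

text \<open>A well-ordering of the cover gives, for each scale \<open>e i\<close>, a discrete family of sets refining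
  the cover; dimension zero turns each of these into a discrete family of clopen sets.\<close>

lemma zero_dim_partition:
  assumes dim: "covering_dim_at_most mtopology 0"
    and N: "\<And>y. y \<in> M \<Longrightarrow> openin mtopology (N y)" "\<And>y. y \<in> M \<Longrightarrow> y \<in> N y"
  obtains \<W> where "\<And>W. W \<in> \<W> \<Longrightarrow> openin mtopology W" "pairwise disjnt \<W>" "\<Union>\<W> = M"
    "\<And>W. W \<in> \<W> \<Longrightarrow> \<exists>y\<in>M. W \<subseteq> N y"
proof -
  obtain R :: "'a rel" where R: "well_order_on UNIV R" using well_order_on by blast
  then have wf: "wf (R - Id)" and tot: "total R" by (auto simp: well_order_on_def linear_order_on_def)
  \<comment> \<open>\<open>\<alpha> y\<close> will be the first centre in the well-order whose
    neighbourhood contains \<open>y\<close>.\<close>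
  have "\<exists>a. y \<in> N a \<and> a \<in> M \<and> (\<forall>b. (b, a) \<in> R - Id \<longrightarrow> b \<in> M \<longrightarrow> y \<notin> N b)" if "y \<in> M" for y
    using wfE_min[OF wf, of y "{a \<in> M. y \<in> N a}"] N(2) that by (smt (verit) mem_Collect_eq)
  then obtain \<alpha> where \<alpha>: "\<And>y. y \<in> M \<Longrightarrow> y \<in> N (\<alpha> y)" "\<And>y. y \<in> M \<Longrightarrow> \<alpha> y \<in> M"
    "\<And>y b. y \<in> M \<Longrightarrow> (b, \<alpha> y) \<in> R - Id \<Longrightarrow> b \<in> M \<Longrightarrow> y \<notin> N b"
    by metis
  define e :: "nat \<Rightarrow> real" where "e i = inverse (real (Suc i))" for i
  have e: "0 < e i" for i by (simp add: e_def)
  \<comment> \<open>Points with first centre \<open>a\<close> lying \<open>e i\<close> deep in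
    \<open>N a\<close>. A point with a later first centre is outside \<open>N a\<close>, so for
    different centres these sets are at distance at least \<open>e i\<close>.\<close>
  define F where "F a i = {y \<in> M. \<alpha> y = a \<and> mball y (e i) \<subseteq> N a}" for a i
  have far': "e i \<le> d y y'" if "y \<in> F a i" "y' \<in> F b i" "(a, b) \<in> R - Id" for a b i y y'
  proof -
    have "a \<in> M" using that \<alpha>(2) by (auto simp: F_def)
    then have "y' \<notin> N a" using that \<alpha>(3)[of y' a] by (auto simp: F_def)
    then show ?thesis using that by (force simp: F_def)
  qed
  have far: "e i \<le> d y y'" if "y \<in> F a i" "y' \<in> F b i" "a \<noteq> b" for a b i y y'
    using far'[of y a i y' b] far'[of y' b i y a] tot that commute[of y y'] by (auto simp: total_on_def)
  \<comment> \<open>Balls of radius \<open>e i / 3\<close> about points at distance at least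
    \<open>e i\<close> cannot meet.\<close>
  define G where "G a i = (\<Union>y\<in>F a i. mball y (e i / 3))" for a i
  have opG: "openin mtopology (G a i)" for a i by (auto simp: G_def)
  have GN: "G a i \<subseteq> N a" for a i using e[of i] by (fastforce simp: G_def F_def)
  have Gdisj: "G a i \<inter> G b i = {}" if "a \<noteq> b" for a b i
  proof -
    have False if p: "p \<in> G a i" "p \<in> G b i" for p
    proof -
      obtain y y' where y: "y \<in> F a i" "p \<in> mball y (e i / 3)" "y' \<in> F b i" "p \<in> mball y' (e i / 3)"
        using p by (auto simp: G_def)
      then have "d y y' \<le> d y p + d y' p" using triangle'[of y p y'] by auto
      then show False using y far[OF y(1,3) \<open>a \<noteq> b\<close>] e[of i] by auto
    qed
    then show ?thesis by blast
  qed
  have "\<exists>C. openin mtopology C \<and> closedin mtopology C \<and> (\<Union>a. F a i) \<subseteq> C \<and> C \<subseteq> (\<Union>a. G a i)" for i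
  proof -
    let ?A = "mtopology closure_of (\<Union>a. F a i)" and ?B = "M - (\<Union>a. G a i)"
    have FM: "(\<Union>a. F a i) \<subseteq> M" by (auto simp: F_def)
    have "?A \<subseteq> (\<Union>a. G a i)"
    proof
      fix x assume "x \<in> ?A"
      then obtain y where y: "y \<in> (\<Union>a. F a i)" "y \<in> mball x (e i / 3)" "x \<in> M"
        unfolding metric_closure_of using e[of i] by (smt (verit) divide_pos_pos mem_Collect_eq)
      then have "x \<in> mball y (e i / 3)" by (simp add: commute)
      then show "x \<in> (\<Union>a. G a i)" using y(1) unfolding G_def by blast
    qed
    then have AB: "?A \<inter> ?B = {}" by blast
    have "openin mtopology (\<Union>a. G a i)" using opG by blast
    then have clB: "closedin mtopology ?B" by (metis closedin_diff closedin_mspace)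
    obtain C where "openin mtopology C" "closedin mtopology C" "?A \<subseteq> C" "C \<inter> ?B = {}"
      by (rule zero_dim_separation[OF dim closedin_closure_of clB AB])
    moreover have "(\<Union>a. F a i) \<subseteq> ?A" using FM by (intro closure_of_subset) simp
    moreover have "C \<subseteq> M" using \<open>openin mtopology C\<close> openin_subset by fastforce
    ultimately show ?thesis by (intro exI[of _ C]) blast
  qed
  then obtain C where C: "\<And>i. openin mtopology (C i)" "\<And>i. closedin mtopology (C i)"
    "\<And>i. (\<Union>a. F a i) \<subseteq> C i" "\<And>i. C i \<subseteq> (\<Union>a. G a i)"
    by metis
  \<comment> \<open>Subtracting the earlier \<open>C j\<close> separates the scales, and the
    \<open>G a i\<close> separate the centres within one scale. Closedness of the \<open>C j\<close>
    keeps \<open>P a i\<close> open.\<close>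
  define P where "P a i = (C i - (\<Union>j<i. C j)) \<inter> G a i" for a i
  have opP: "openin mtopology (P a i)" for a i
    unfolding P_def using C(1,2) opG by (intro openin_Int openin_diff closedin_Union) auto
  have Pdisj: "P a i \<inter> P b j = {}" if "(a, i) \<noteq> (b, j)" for a b i j
  proof (cases i j rule: linorder_cases)
    case equal
    then show ?thesis using Gdisj[of a b i] that by (auto simp: P_def)
  qed (auto simp: P_def)
  show ?thesis
  proof (rule that[of "{P a i | a i. a \<in> M}"])
    show "openin mtopology W" if "W \<in> {P a i | a i. a \<in> M}" for W using that opP by blast
    show "pairwise disjnt {P a i | a i. a \<in> M}"
    proof (rule pairwiseI)
      fix A B assume "A \<in> {P a i | a i. a \<in> M}" "B \<in> {P a i | a i. a \<in> M}" "A \<noteq> B"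
      then obtain a i b j where "A = P a i" "B = P b j" "(a, i) \<noteq> (b, j)" by blast
      then show "disjnt A B" using Pdisj by (simp add: disjnt_def)
    qed
    show "\<exists>y\<in>M. W \<subseteq> N y" if W: "W \<in> {P a i | a i. a \<in> M}" for W
    proof -
      obtain a i where a: "a \<in> M" "W = P a i" using W by blast
      then have "W \<subseteq> N a" using GN[of a i] by (auto simp: P_def)
      then show ?thesis using a(1) by blast
    qed
    show "\<Union>{P a i | a i. a \<in> M} = M"
    proof
      have "P a i \<subseteq> M" for a i using opP openin_subset by fastforce
      then show "\<Union>{P a i | a i. a \<in> M} \<subseteq> M" by blast
      show "M \<subseteq> \<Union>{P a i | a i. a \<in> M}"
      proof
        fix y assume y: "y \<in> M"
        obtain r where r: "r > 0" "mball y r \<subseteq> N (\<alpha> y)"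
          using N(1)[OF \<alpha>(2)[OF y]] \<alpha>(1)[OF y] unfolding openin_mtopology by blast
        obtain i where "e i < r" using reals_Archimedean[OF r(1)] by (auto simp: e_def)
        then have "mball y (e i) \<subseteq> N (\<alpha> y)" using r(2) mball_subset_concentric[of "e i" r y] by auto
        then have "y \<in> F (\<alpha> y) i" using y by (simp add: F_def)
        then have yC: "y \<in> C i" using C(3)[of i] by blast
        \<comment> \<open>The first scale whose clopen set contains \<open>y\<close>; the centre
          \<open>a\<close> found there may differ from \<open>\<alpha> y\<close>.\<close>
        define k where "k = (LEAST i. y \<in> C i)"
        have k: "y \<notin> C j" if "j < k" for j
          using not_less_Least[of j "\<lambda>i. y \<in> C i"] that k_def by auto
        have yk: "y \<in> C k" unfolding k_def using yC by (rule LeastI)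
        then obtain a where a: "y \<in> G a k" using C(4)[of k] by blast
        then have "F a k \<noteq> {}" by (auto simp: G_def)
        then have "a \<in> M" using \<alpha>(2) by (auto simp: F_def)
        moreover have "y \<in> P a k" using a yk k by (auto simp: P_def)
        ultimately show "y \<in> \<Union>{P a i | a i. a \<in> M}" by blast
      qed
    qed
  qed
qed

end

section \<open>General position and nerve maps\<close>

text \<open>Collinearity is the equality case of the Cauchy-Schwarz inequality, an equation between
  continuous functions.\<close>

lemma closed_collinear: "closed {(x, y, z). collinear {x, y, z :: 'a::euclidean_space}}"
proof -
  have "{(x, y, z). collinear {x, y, z :: 'a}} =
      {p. \<bar>(fst p - fst (snd p)) \<bullet> (snd (snd p) - fst (snd p))\<bar>
          = norm (fst p - fst (snd p)) * norm (snd (snd p) - fst (snd p))}"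
    by (subst collinear_3) (auto simp: norm_cauchy_schwarz_equal)
  then show ?thesis by (auto intro!: closed_Collect_eq continuous_intros)
qed

lemma ex_line_iff_collinear:
  fixes x y z :: "'a::euclidean_space"
  assumes "y \<noteq> z"
  shows "(\<exists>L. affine L \<and> aff_dim L = 1 \<and> z \<in> L \<and> x \<in> L \<and> y \<in> L) \<longleftrightarrow> collinear {x, z, y}"
proof
  assume "\<exists>L. affine L \<and> aff_dim L = 1 \<and> z \<in> L \<and> x \<in> L \<and> y \<in> L"
  then obtain L where L: "aff_dim L = 1" "{x, z, y} \<subseteq> L" by blast
  then have "aff_dim {x, z, y} \<le> 1" using aff_dim_subset[OF L(2)] by simp
  then show "collinear {x, z, y}" by (simp add: collinear_aff_dim)
next
  assume "collinear {x, z, y}"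
  then have "collinear {z, y, x}" by (simp add: insert_commute)
  then have x: "x \<in> affine hull {z, y}" using collinear_3_affine_hull[of z y x] assms by blast
  have "z \<in> affine hull {z, y}" "y \<in> affine hull {z, y}" by (auto intro: hull_inc)
  moreover have "aff_dim (affine hull {z, y}) = 1" using assms by simp
  ultimately show "\<exists>L. affine L \<and> aff_dim L = 1 \<and> z \<in> L \<and> x \<in> L \<and> y \<in> L"
    using x affine_affine_hull by blast
qed

text \<open>Vertices are chosen one by one: the affine hulls of at most \<open>DIM('n)\<close>
  earlier vertices are finitely many negligible sets and cannot fill the ball prescribed for the
  next vertex.\<close>

lemma general_position:
  fixes a :: "'i \<Rightarrow> 'n::euclidean_space"
  assumes "finite I" "\<And>i. i \<in> I \<Longrightarrow> 0 < e i"
  shows "\<exists>p. (\<forall>i\<in>I. dist (p i) (a i) < e i) \<and>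
     (\<forall>J\<subseteq>I. card J \<le> DIM('n) + 1 \<longrightarrow> inj_on p J \<and> \<not> affine_dependent (p ` J))"
  using assms
proof (induction I)
  case empty
  then show ?case by (simp add: affine_dependent_def)
next
  case (insert i I)
  then obtain p where p: "\<forall>j\<in>I. dist (p j) (a j) < e j"
     and gp: "\<And>J. J \<subseteq> I \<Longrightarrow> card J \<le> DIM('n) + 1 \<Longrightarrow> inj_on p J \<and> \<not> affine_dependent (p ` J)"
    by auto
  define \<N> where "\<N> = (\<lambda>J. affine hull (p ` J)) ` {J. J \<subseteq> I \<and> card J \<le> DIM('n)}"
  have "negligible (\<Union>\<N>)"
  proof (rule negligible_Union)
    show "finite \<N>" unfolding \<N>_def using insert.hyps(1) by simp
    fix N assume "N \<in> \<N>"
    then obtain J where J: "N = affine hull (p ` J)" "J \<subseteq> I" "card J \<le> DIM('n)" by (auto simp: \<N>_def)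
    have "finite J" using J(2) insert.hyps(1) finite_subset by blast
    then have "interior N = {}" unfolding J(1) using J(3) card_image_le[of J p]
      by (intro empty_interior_affine_hull) auto
    then show "negligible N" using negligible_convex_interior[of N] J(1) by simp
  qed
  moreover have "\<not> negligible (ball (a i) (e i))"
    using insert.prems[of i] by (intro open_not_negligible) auto
  ultimately obtain q where q: "q \<in> ball (a i) (e i)" "q \<notin> \<Union>\<N>"
    by (meson negligible_subset subsetI)
  show ?case
  proof (intro exI[of _ "p(i := q)"] conjI ballI allI impI)
    show "dist ((p(i := q)) j) (a j) < e j" if "j \<in> insert i I" for j
      using that p q(1) by (auto simp: dist_commute)
    fix J assume J: "J \<subseteq> insert i I" "card J \<le> DIM('n) + 1"
    define J' where "J' = J - {i}"
    have J': "J' \<subseteq> I" "i \<notin> J'" "finite J'" using J(1) insert.hyps finite_subset by (auto simp: J'_def)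
    have im: "(p(i := q)) ` J' = p ` J'" "inj_on (p(i := q)) J' \<longleftrightarrow> inj_on p J'"
      using J' by (auto simp: inj_on_def)
    have "inj_on (p(i := q)) J \<and> \<not> affine_dependent ((p(i := q)) ` J)"
    proof (cases "i \<in> J")
      case False
      then have "J = J'" by (auto simp: J'_def)
      then show ?thesis using gp[OF J'(1)] J(2) im by simp
    next
      case True
      then have ins: "J = insert i J'" by (auto simp: J'_def)
      have card: "card J' \<le> DIM('n)" using J(2) J' ins by simp
      then have g: "inj_on p J' \<and> \<not> affine_dependent (p ` J')" using gp[OF J'(1)] by simp
      have qn: "q \<notin> affine hull (p ` J')" using q(2) card J'(1) by (auto simp: \<N>_def)
      then have "q \<notin> p ` J'" using hull_inc by metis
      then have "inj_on (p(i := q)) J" unfolding ins using J'(2) g im by (subst inj_on_insert) auto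
      moreover have "(p(i := q)) ` J = insert q (p ` J')" unfolding ins image_insert im(1) by simp
      ultimately show ?thesis using affine_independent_insert[OF _ qn] g by simp
    qed
    then show "inj_on (p(i := q)) J" "\<not> affine_dependent ((p(i := q)) ` J)" by auto
  qed
qed

text \<open>In barycentric coordinates the parameter of \<open>z\<close> on the segment is the total weight of \<open>z\<close>
  on \<open>S\<close>, so it does not depend on the line.\<close>

lemma transversal_unique:
  fixes S T :: "'n::euclidean_space set"
  assumes ind: "\<not> affine_dependent (S \<union> T)" and disj: "S \<inter> T = {}"
    and y: "y1 \<in> affine hull S" "y2 \<in> affine hull T" and u: "u1 \<in> affine hull S" "u2 \<in> affine hull T"
    and z: "z \<noteq> y1" "z \<noteq> y2" "z \<noteq> u1" "z \<noteq> u2"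
    and col: "collinear {y1, z, y2}" "collinear {u1, z, u2}"
  shows "y1 = u1 \<and> y2 = u2"
proof -
  have fin: "finite S" "finite T" using ind aff_independent_finite by auto
  have dh: "affine hull S \<inter> affine hull T = {}" using disjoint_affine_hull[OF ind _ _ disj] by auto
  have "y1 \<noteq> y2" "u1 \<noteq> u2" using dh y u by auto
  then obtain s s' where s: "z = s *\<^sub>R y1 + (1 - s) *\<^sub>R y2" and s': "z = s' *\<^sub>R u1 + (1 - s') *\<^sub>R u2"
    using col unfolding collinear_3_expand by metis
  \<comment> \<open>Consequences of \<open>z \<noteq> y2\<close> and \<open>z \<noteq> y1\<close>;
    both factors are cancelled when the coefficients are compared at the end.\<close>
  have s0: "s \<noteq> 0" "s \<noteq> 1" using s z by auto
  obtain a where a: "sum a S = 1" "(\<Sum>v\<in>S. a v *\<^sub>R v) = y1" using y(1) fin by (auto simp: affine_hull_finite)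
  obtain a' where a': "sum a' S = 1" "(\<Sum>v\<in>S. a' v *\<^sub>R v) = u1" using u(1) fin by (auto simp: affine_hull_finite)
  obtain b where b: "sum b T = 1" "(\<Sum>v\<in>T. b v *\<^sub>R v) = y2" using y(2) fin by (auto simp: affine_hull_finite)
  obtain b' where b': "sum b' T = 1" "(\<Sum>v\<in>T. b' v *\<^sub>R v) = u2" using u(2) fin by (auto simp: affine_hull_finite)
  \<comment> \<open>The difference of two expressions of \<open>z\<close> in the vertices. Its
    coefficients add up to 0 and its combination vanishes, so independence kills each coefficient;
    the sum over \<open>S\<close> then gives \<open>s = s'\<close>.\<close>
  define c where "c v = (if v \<in> S then s * a v - s' * a' v else (1 - s) * b v - (1 - s') * b' v)" for v
  have cS: "c v = s * a v - s' * a' v" if "v \<in> S" for v using that by (simp add: c_def)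
  have cT: "c v = (1 - s) * b v - (1 - s') * b' v" if "v \<in> T" for v using that disj by (auto simp: c_def)
  have sumS: "sum c S = s - s'"
  proof -
    have "sum c S = (\<Sum>v\<in>S. s * a v - s' * a' v)" by (simp add: cS)
    also have "\<dots> = s - s'" using a a' by (simp add: sum_subtractf flip: sum_distrib_left)
    finally show ?thesis .
  qed
  have sumT: "sum c T = s' - s"
  proof -
    have "sum c T = (\<Sum>v\<in>T. (1 - s) * b v - (1 - s') * b' v)" by (simp add: cT)
    also have "\<dots> = s' - s" using b b' by (simp add: sum_subtractf flip: sum_distrib_left)
    finally show ?thesis .
  qed
  have "(\<Sum>v\<in>S. c v *\<^sub>R v) = s *\<^sub>R y1 - s' *\<^sub>R u1"
    using a a' by (simp add: cS scaleR_diff_left sum_subtractf scaleR_right.sum[symmetric] flip: scaleR_scaleR)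
  moreover have "(\<Sum>v\<in>T. c v *\<^sub>R v) = (1 - s) *\<^sub>R y2 - (1 - s') *\<^sub>R u2"
    using b b' by (simp add: cT scaleR_diff_left[of "_ * _"] sum_subtractf scaleR_right.sum[symmetric] flip: scaleR_scaleR)
  ultimately have "(\<Sum>v\<in>S \<union> T. c v *\<^sub>R v) = 0"
    using s s' fin disj by (simp add: sum.union_disjoint flip: add_diff_add)
  moreover have "sum c (S \<union> T) = 0" using fin disj sumS sumT by (simp add: sum.union_disjoint)
  ultimately have c0: "c v = 0" if "v \<in> S \<union> T" for v
    using ind that fin affine_dependent_explicit_finite[of "S \<union> T"] by blast
  then have ss: "s' = s" using sumS by simp
  have "a v = a' v" if "v \<in> S" for v using c0[of v] cS[OF that] that s0 ss by simp
  moreover have "b v = b' v" if "v \<in> T" for v using c0[of v] cT[OF that] that s0 ss by simp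
  ultimately show ?thesis using a b a' b' by auto
qed

section \<open>Nerve maps in general position near a compact set\<close>

context Metric_space
begin

text \<open>The nerve map of a fine cover of order at most \<open>n + 1\<close>, with vertices in general position:
  points at distance at least \<open>\<delta>\<close> have carriers without a common vertex.\<close>

lemma nerve_map:
  fixes g0 :: "'a \<Rightarrow> 'n::euclidean_space"
  assumes K: "compactin mtopology K" and dim: "covering_dim_at_most (subtopology mtopology K) (int n)"
    and n: "2 * n + 1 \<le> DIM('n)"
    and g0: "continuous_map mtopology euclidean g0"
    and \<epsilon>: "continuous_map mtopology euclideanreal \<epsilon>" "\<And>x. x \<in> M \<Longrightarrow> 0 < \<epsilon> x" and \<delta>: "0 < \<delta>"
  obtains W h where "openin mtopology W" "K \<subseteq> W" "continuous_map (subtopology mtopology W) euclidean h"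
    "\<And>x. x \<in> W \<Longrightarrow> dist (h x) (g0 x) < \<epsilon> x"
    "\<And>z. finite {(h x1, h x2) | x1 x2. x1 \<in> W \<and> x2 \<in> W \<and> \<delta> \<le> d x1 x2 \<and>
              h x1 \<noteq> z \<and> h x2 \<noteq> z \<and> collinear {h x1, z, h x2}}"
proof -
  have KM: "K \<subseteq> M" using K compactin_subset_topspace by fastforce
  \<comment> \<open>The three conditions make distances in \<open>U c\<close> smaller than
    \<open>\<delta>\<close>, keep \<open>g0\<close> within \<open>\<epsilon> c / 4\<close> of its
    value at \<open>c\<close>, and keep \<open>\<epsilon>\<close> above
    \<open>\<epsilon> c / 2\<close>.\<close>
  define U where "U c = mball c (\<delta> / 2) \<inter> {x \<in> M. g0 x \<in> ball (g0 c) (\<epsilon> c / 4)} \<inter> {x \<in> M. \<epsilon> x \<in> {\<epsilon> c / 2<..}}" for c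
  have opU: "openin mtopology (U c)" for c
    unfolding U_def
    using openin_continuous_map_preimage[OF g0, of "ball (g0 c) (\<epsilon> c / 4)"]
      openin_continuous_map_preimage[OF \<epsilon>(1), of "{\<epsilon> c / 2<..}"]
    by (intro openin_Int openin_mball) auto
  have cU: "c \<in> U c" if "c \<in> M" for c using that \<epsilon>(2)[OF that] \<delta> by (simp add: U_def)
  have "K \<subseteq> \<Union>(U ` K)" using cU KM by blast
  then obtain \<F> where F: "finite \<F>" "\<F> \<subseteq> U ` K" "K \<subseteq> \<Union>\<F>"
    using compactinD[OF K, of "U ` K"] opU by auto
  then obtain C where C: "finite C" "C \<subseteq> K" "K \<subseteq> \<Union>(U ` C)"
    using finite_subset_image[OF F(1,2)] by auto
  let ?\<U> = "(\<lambda>c. K \<inter> U c) ` C"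
  have cov: "finite ?\<U> \<and> (\<forall>V\<in>?\<U>. openin (subtopology mtopology K) V) \<and> \<Union>?\<U> = topspace (subtopology mtopology K)"
    using C KM opU by (auto simp: openin_subtopology_Int2)
  obtain \<V> where V: "finite \<V>" "\<forall>V\<in>\<V>. openin (subtopology mtopology K) V"
      "\<Union>\<V> = topspace (subtopology mtopology K)" "\<forall>V\<in>\<V>. \<exists>U\<in>?\<U>. V \<subseteq> U"
    and ord: "\<forall>x\<in>topspace (subtopology mtopology K). int (card {V\<in>\<V>. x \<in> V}) \<le> int n + 1"
    using mp[OF spec[OF conjunct2[OF dim[unfolded covering_dim_at_most_def]]] cov] by (elim exE conjE)
  have tK: "topspace (subtopology mtopology K) = K" using KM by auto
  have VK: "V \<subseteq> K" if "V \<in> \<V>" for V using that V(3) tK by blast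
  have "\<forall>V\<in>\<V>. \<exists>c. c \<in> C \<and> V \<subseteq> U c" using V(4) by blast
  then obtain c where c: "\<And>V. V \<in> \<V> \<Longrightarrow> c V \<in> C" "\<And>V. V \<in> \<V> \<Longrightarrow> V \<subseteq> U (c V)" by metis
  have cM: "c V \<in> M" if "V \<in> \<V>" for V using c(1)[OF that] C(2) KM by blast
  \<comment> \<open>Open in the whole space, so that \<open>h\<close> lives on a neighbourhood of
    \<open>K\<close>. The thickening preserves the order of the cover, and \<open>U (c V)\<close>
    retains the three bounds.\<close>
  define E where "E V = thicken K V \<inter> U (c V)" for V
  have opE: "openin mtopology (E V)" for V unfolding E_def by (intro openin_Int openin_thicken opU)
  have EM: "E V \<subseteq> M" for V using opE openin_subset by fastforce
  have VE: "V \<subseteq> E V" if "V \<in> \<V>" for V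
    using subset_thicken[of K V] V(2) c(2)[OF that] that by (auto simp: E_def)
  define \<sigma> where "\<sigma> x = {V \<in> \<V>. x \<in> E V}" for x
  have card\<sigma>: "card (\<sigma> x) \<le> n + 1" for x
  proof (cases "\<sigma> x = {}")
    case False
    have "finite (\<sigma> x)" using V(1) by (simp add: \<sigma>_def)
    then obtain q where q: "q \<in> K" "\<And>V. V \<in> \<sigma> x \<Longrightarrow> q \<in> V"
      using False
    proof (rule thicken_common_point[of _ x K])
      show "x \<in> thicken K V" if "V \<in> \<sigma> x" for V using that by (simp add: \<sigma>_def E_def)
      show "V \<subseteq> K" if "V \<in> \<sigma> x" for V using that VK by (simp add: \<sigma>_def)
    qed blast
    have "card (\<sigma> x) \<le> card {V \<in> \<V>. q \<in> V}"
      using q(2) V(1) by (intro card_mono) (auto simp: \<sigma>_def)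
    also have "\<dots> \<le> n + 1" using ord q(1) tK by force
    finally show ?thesis .
  qed simp
  have "\<exists>p. (\<forall>V\<in>\<V>. dist (p V) (g0 (c V)) < \<epsilon> (c V) / 4) \<and>
     (\<forall>J\<subseteq>\<V>. card J \<le> DIM('n) + 1 \<longrightarrow> inj_on p J \<and> \<not> affine_dependent (p ` J))"
    using general_position[OF V(1), of "\<lambda>V. \<epsilon> (c V) / 4" "\<lambda>V. g0 (c V)"] \<epsilon>(2) cM by simp
  then obtain p where p: "\<And>V. V \<in> \<V> \<Longrightarrow> dist (p V) (g0 (c V)) < \<epsilon> (c V) / 4"
     and gp: "\<And>J. J \<subseteq> \<V> \<Longrightarrow> card J \<le> DIM('n) + 1 \<Longrightarrow> inj_on p J \<and> \<not> affine_dependent (p ` J)"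
    by auto
  \<comment> \<open>Functions positive exactly on the sets \<open>E V\<close>; divided by their sum
    they form a partition of unity on \<open>W\<close>.\<close>
  have "\<forall>V. \<exists>\<phi>. continuous_map mtopology euclideanreal \<phi> \<and> (\<forall>x. 0 \<le> \<phi> x) \<and> (\<forall>x\<in>M. 0 < \<phi> x \<longleftrightarrow> x \<in> E V)"
    using openin_cozero[OF opE] by metis
  then obtain \<phi> where \<phi>: "\<And>V. continuous_map mtopology euclideanreal (\<phi> V)" "\<And>V x. 0 \<le> \<phi> V x"
     "\<And>V x. x \<in> M \<Longrightarrow> 0 < \<phi> V x \<longleftrightarrow> x \<in> E V"
    by metis
  define W where "W = \<Union>(E ` \<V>)"
  have WM: "W \<subseteq> M" using EM by (auto simp: W_def)
  define \<Phi> where "\<Phi> x = (\<Sum>V\<in>\<V>. \<phi> V x)" for x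
  have \<Phi>: "0 < \<Phi> x" if x: "x \<in> W" for x
  proof -
    obtain V where "V \<in> \<V>" "x \<in> E V" using x by (auto simp: W_def)
    then show ?thesis unfolding \<Phi>_def using \<phi>(2,3) V(1) WM x by (intro sum_pos2[of _ V]) auto
  qed
  define h where "h x = (\<Sum>V\<in>\<V>. (\<phi> V x / \<Phi> x) *\<^sub>R p V)" for x
  \<comment> \<open>Only members of \<open>\<sigma> x\<close> have positive weight at
    \<open>x\<close>, so \<open>\<sigma> x\<close> is the carrier of \<open>h x\<close> in the
    nerve.\<close>
  have hconv: "h x \<in> convex hull (p ` \<sigma> x)" if x: "x \<in> W" for x
  proof -
    have xM: "x \<in> M" using x WM by blast
    have zero: "\<phi> V x = 0" if "V \<in> \<V> - \<sigma> x" for V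
      using that \<phi>(2)[of V x] \<phi>(3)[OF xM, of V] by (auto simp: \<sigma>_def)
    have "h x = (\<Sum>V\<in>\<sigma> x. (\<phi> V x / \<Phi> x) *\<^sub>R p V)"
      unfolding h_def using V(1) zero by (intro sum.mono_neutral_right) (auto simp: \<sigma>_def)
    moreover have "(\<Sum>V\<in>\<sigma> x. \<phi> V x / \<Phi> x) = 1"
    proof -
      have "(\<Sum>V\<in>\<sigma> x. \<phi> V x) = \<Phi> x"
        unfolding \<Phi>_def using V(1) zero by (intro sum.mono_neutral_left) (auto simp: \<sigma>_def)
      then show ?thesis using \<Phi>[OF x] by (simp flip: sum_divide_distrib)
    qed
    ultimately show ?thesis
      using V(1) \<phi>(2) \<Phi>[OF x] by (simp only:) (intro convex_sum; auto simp: \<sigma>_def intro: hull_inc)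
  qed
  show ?thesis
  proof (rule that)
    show "openin mtopology W" unfolding W_def using opE by auto
    show "K \<subseteq> W"
    proof
      fix x assume "x \<in> K"
      then obtain V where "V \<in> \<V>" "x \<in> V" using V(3) tK by blast
      then show "x \<in> W" using VE unfolding W_def by blast
    qed
    show "continuous_map (subtopology mtopology W) euclidean h"
    proof -
      have c1: "continuous_map (subtopology mtopology W) euclideanreal (\<phi> V)" for V
        by (rule continuous_map_from_subtopology[OF \<phi>(1)])
      have c2: "continuous_map (subtopology mtopology W) euclideanreal \<Phi>"
        unfolding \<Phi>_def[abs_def] using c1 V(1) by (intro continuous_map_sum) auto
      have c3: "continuous_map (subtopology mtopology W) euclideanreal (\<lambda>x. \<phi> V x / \<Phi> x)" for V
        using c1 c2 \<Phi> by (intro continuous_map_real_divide) (auto simp: less_le)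
      have c4: "continuous_map (subtopology mtopology W) euclidean (\<lambda>x. (\<phi> V x / \<Phi> x) *\<^sub>R p V)" for V
        using c3[of V] by (simp add: continuous_map_atin tendsto_scaleR)
      show ?thesis unfolding h_def[abs_def] using V(1) c4 by (intro continuous_map_sum) auto
    qed
    show "dist (h x) (g0 x) < \<epsilon> x" if x: "x \<in> W" for x
    proof -
      \<comment> \<open>From \<open>p V\<close> to \<open>g0 (c V)\<close> and on to
        \<open>g0 x\<close> costs less than \<open>\<epsilon> (c V) / 4\<close> each, together less
        than \<open>\<epsilon> (c V) / 2 < \<epsilon> x\<close>.\<close>
      have "p V \<in> ball (g0 x) (\<epsilon> x)" if "V \<in> \<sigma> x" for V
      proof -
        have V': "V \<in> \<V>" "x \<in> U (c V)" using that by (auto simp: \<sigma>_def E_def)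
        then have "dist (g0 (c V)) (g0 x) < \<epsilon> (c V) / 4" "\<epsilon> (c V) / 2 < \<epsilon> x" by (auto simp: U_def)
        then show ?thesis using p[OF V'(1)] dist_triangle[of "p V" "g0 x" "g0 (c V)"] by (simp add: dist_commute)
      qed
      then have "convex hull (p ` \<sigma> x) \<subseteq> ball (g0 x) (\<epsilon> x)" by (intro hull_minimal) auto
      then show ?thesis using hconv[OF x] by (auto simp: dist_commute)
    qed
    fix z
    define A where "A J L = {(y1, y2). y1 \<in> affine hull (p ` J) \<and> y2 \<in> affine hull (p ` L) \<and> y1 \<noteq> z \<and> y2 \<noteq> z \<and> collinear {y1, z, y2}}" for J L
    \<comment> \<open>There are finitely many pairs of disjoint carriers, and each contributes at
      most one pair of values for the fixed \<open>z\<close>.\<close>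
    define \<P> where "\<P> = {(J, L). J \<subseteq> \<V> \<and> L \<subseteq> \<V> \<and> J \<inter> L = {} \<and> card J \<le> n + 1 \<and> card L \<le> n + 1}"
    have finA: "finite (A J L)" if JL: "(J, L) \<in> \<P>" for J L
    proof -
      have *: "J \<union> L \<subseteq> \<V>" "J \<inter> L = {}" using JL by (auto simp: \<P>_def)
      have "card (J \<union> L) \<le> card J + card L" by (rule card_Un_le)
      \<comment> \<open>Two carriers have at most \<open>2 * n + 2\<close> vertices, still within
        the range of general position.\<close>
      also have "\<dots> \<le> DIM('n) + 1" using JL n by (auto simp: \<P>_def)
      finally have g: "inj_on p (J \<union> L) \<and> \<not> affine_dependent (p ` (J \<union> L))" using gp[OF *(1)] by simp
      then have "p ` J \<inter> p ` L = {}" using * inj_on_image_Int[of p "J \<union> L" J L] by auto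
      moreover have "\<not> affine_dependent (p ` J \<union> p ` L)" using g by (simp add: image_Un)
      ultimately have eq: "a = b" if ab: "a \<in> A J L" "b \<in> A J L" for a b
        using transversal_unique[of "p ` J" "p ` L" "fst a" "snd a" "fst b" "snd b" z] ab by (auto simp: A_def)
      show ?thesis
      proof (cases "A J L = {}")
        case False
        then obtain a where "a \<in> A J L" by blast
        then have "A J L \<subseteq> {a}" using eq by blast
        then show ?thesis using finite_subset by blast
      qed simp
    qed
    have "\<P> \<subseteq> Pow \<V> \<times> Pow \<V>" by (auto simp: \<P>_def)
    then have "finite \<P>" using V(1) finite_subset by fastforce
    then have "finite (\<Union>(J, L)\<in>\<P>. A J L)" using finA by auto
    moreover have "(h x1, h x2) \<in> (\<Union>(J, L)\<in>\<P>. A J L)"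
      if x: "x1 \<in> W" "x2 \<in> W" "\<delta> \<le> d x1 x2" "h x1 \<noteq> z" "h x2 \<noteq> z" "collinear {h x1, z, h x2}" for x1 x2
    proof -
      have "V \<notin> \<sigma> x2" if "V \<in> \<sigma> x1" for V
      proof
        assume "V \<in> \<sigma> x2"
        then have "x1 \<in> mball (c V) (\<delta> / 2)" "x2 \<in> mball (c V) (\<delta> / 2)" using that by (auto simp: \<sigma>_def E_def U_def)
        then have "d x1 x2 < \<delta>" using triangle''[of x1 "c V" x2] by auto
        then show False using x(3) by simp
      qed
      then have "(\<sigma> x1, \<sigma> x2) \<in> \<P>" using card\<sigma> by (auto simp: \<P>_def) (auto simp: \<sigma>_def)
      moreover have "(h x1, h x2) \<in> A (\<sigma> x1) (\<sigma> x2)"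
        using hconv[OF x(1)] hconv[OF x(2)] x(4-6) convex_hull_subset_affine_hull by (auto simp: A_def)
      ultimately show ?thesis by blast
    qed
    then have "{(h x1, h x2) | x1 x2. x1 \<in> W \<and> x2 \<in> W \<and> \<delta> \<le> d x1 x2 \<and>
              h x1 \<noteq> z \<and> h x2 \<noteq> z \<and> collinear {h x1, z, h x2}} \<subseteq> (\<Union>(J, L)\<in>\<P>. A J L)"
      by blast
    ultimately show "finite {(h x1, h x2) | x1 x2. x1 \<in> W \<and> x2 \<in> W \<and> \<delta> \<le> d x1 x2 \<and>
              h x1 \<noteq> z \<and> h x2 \<noteq> z \<and> collinear {h x1, z, h x2}}"
      using finite_subset by blast
  qed
qed

end

section \<open>The Baire property of the source limitation topology\<close>

lemma continuous_map_unit_iff: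
  "continuous_map X (top_of_set {0<..1}) \<epsilon> \<longleftrightarrow>
     continuous_map X euclideanreal \<epsilon> \<and> (\<forall>x\<in>topspace X. 0 < \<epsilon> x \<and> \<epsilon> x \<le> 1)"
  by (auto simp: continuous_map_in_subtopology Pi_iff)

text \<open>In the construction the radii \<open>e\<^sub>k\<close> satisfy
  \<open>dist (g\<^sub>k\<^sub>+\<^sub>1 x) (g\<^sub>k x) \<le> e\<^sub>k x - e\<^sub>k\<^sub>+\<^sub>1 x\<close>, so that the distances telescope.\<close>

lemma source_limitation_Baire:
  fixes W :: "nat \<Rightarrow> ('a \<Rightarrow> 'm::complete_space) set"
  assumes op: "\<And>k. openin (source_limitation_topology X) (W k)"
    and dense: "\<And>k h \<epsilon>. h \<in> cont_maps X \<Longrightarrow> continuous_map X (top_of_set {0<..1}) \<epsilon> \<Longrightarrow> W k \<inter> sl_ball X h \<epsilon> \<noteq> {}"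
    and h: "h \<in> cont_maps X" and \<epsilon>: "continuous_map X (top_of_set {0<..1}) \<epsilon>"
  shows "(\<Inter>k. W k) \<inter> sl_ball X h \<epsilon> \<noteq> {}"
proof -
  define good where "good = (\<lambda>(g :: 'a \<Rightarrow> 'm, e :: 'a \<Rightarrow> real). g \<in> cont_maps X \<and> continuous_map X (top_of_set {0<..1}) e)"
  have half: "continuous_map X (top_of_set {0<..1}) (\<lambda>x. e x / 2)" if "continuous_map X (top_of_set {0<..1}) e" for e :: "'a \<Rightarrow> real"
  proof -
    have "continuous_map X euclideanreal (\<lambda>x. e x / 2)"
      using that unfolding continuous_map_unit_iff by (intro continuous_map_real_divide) auto
    moreover have "0 < e x / 2 \<and> e x / 2 \<le> 1" if x: "x \<in> topspace X" for x
      using \<open>continuous_map X (top_of_set {0<..1}) e\<close> x unfolding continuous_map_unit_iff by fastforce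
    ultimately show ?thesis unfolding continuous_map_unit_iff by blast
  qed
  \<comment> \<open>The closed ball about \<open>g'\<close> has to lie in \<open>W k\<close>, since
    the limit inherits only weak inequalities; halving the radii forces uniform convergence.\<close>
  define R where "R k = (\<lambda>(g :: 'a \<Rightarrow> 'm, e :: 'a \<Rightarrow> real) (g', e').
      (\<forall>x\<in>topspace X. dist (g' x) (g x) \<le> e x - e' x \<and> e' x \<le> e x / 2) \<and>
      {k \<in> cont_maps X. \<forall>x\<in>topspace X. dist (k x) (g' x) \<le> e' x} \<subseteq> W k)" for k
  \<comment> \<open>Starting at \<open>\<epsilon> / 2\<close> turns the weak final estimate into the
    strict one in \<open>sl_ball X h \<epsilon>\<close>.\<close>
  obtain s where s: "\<And>k. good (s k)" "s 0 = (h, \<lambda>x. \<epsilon> x / 2)" "\<And>k. R k (s k) (s (Suc k))"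
  proof -
    have "\<exists>s. \<forall>k. (good (s k) \<and> (k = 0 \<longrightarrow> s k = (h, \<lambda>x. \<epsilon> x / 2))) \<and> R k (s k) (s (Suc k))"
    proof (rule dependent_nat_choice)
      have "continuous_map X (top_of_set {0<..1}) (\<lambda>x. \<epsilon> x / 2)"
        using half \<epsilon> by blast
      then show "\<exists>s. good s \<and> ((0::nat) = 0 \<longrightarrow> s = (h, \<lambda>x. \<epsilon> x / 2))" using h by (simp add: good_def)
    next
      fix s and k :: nat assume s: "good s \<and> (k = 0 \<longrightarrow> s = (h, \<lambda>x. \<epsilon> x / 2))"
      obtain g e where ge: "s = (g, e)" "g \<in> cont_maps X" "continuous_map X euclideanreal e"
          "\<And>x. x \<in> topspace X \<Longrightarrow> 0 < e x \<and> e x \<le> 1"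
        using s by (cases s) (auto simp: good_def continuous_map_unit_iff)
      have "continuous_map X (top_of_set {0<..1}) (\<lambda>x. e x / 2)"
        using half ge(3,4) unfolding continuous_map_unit_iff by blast
      then obtain g' where g': "g' \<in> W k" "g' \<in> sl_ball X g (\<lambda>x. e x / 2)" using dense[OF ge(2)] by blast
      then obtain e1 where e1: "continuous_map X euclideanreal e1" "\<And>x. x \<in> topspace X \<Longrightarrow> 0 < e1 x \<and> e1 x \<le> 1"
          "sl_ball X g' e1 \<subseteq> W k"
        using op[of k] unfolding openin_source_limitation_topology continuous_map_unit_iff by blast
      \<comment> \<open>\<open>e' x \<le> e x / 2\<close> leaves room for the move of less than
        \<open>e x / 2\<close> from \<open>g\<close> to \<open>g'\<close>, and
        \<open>e' x < e1 x\<close> puts the closed ball into \<open>W k\<close>.\<close>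
      define e' where "e' x = min (e x) (e1 x) / 2" for x
      have "continuous_map X (top_of_set {0<..1}) e'"
        unfolding e'_def[abs_def]
      proof (rule half)
        show "continuous_map X (top_of_set {0<..1}) (\<lambda>x. min (e x) (e1 x))"
          unfolding continuous_map_unit_iff
          using continuous_map_real_min[OF ge(3) e1(1)] ge(4) e1(2) by (simp add: min_le_iff_disj)
      qed
      then have "good (g', e')" using g'(2) by (simp add: good_def sl_ball_def)
      moreover have "R k s (g', e')"
      proof -
        have "dist (g' x) (g x) \<le> e x - e' x \<and> e' x \<le> e x / 2" if "x \<in> topspace X" for x
          using g'(2) that by (fastforce simp: sl_ball_def e'_def)
        moreover have "l \<in> W k" if l: "l \<in> cont_maps X" "\<forall>x\<in>topspace X. dist (l x) (g' x) \<le> e' x" for l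
        proof -
          have "dist (l x) (g' x) < e1 x" if "x \<in> topspace X" for x
            using l(2) that e1(2)[OF that] by (fastforce simp: e'_def)
          then show ?thesis using e1(3) l(1) by (auto simp: sl_ball_def)
        qed
        ultimately show ?thesis by (auto simp: R_def ge(1))
      qed
      ultimately show "\<exists>s'. (good s' \<and> (Suc k = 0 \<longrightarrow> s' = (h, \<lambda>x. \<epsilon> x / 2))) \<and> R k s s'" by auto
    qed
    then show ?thesis using that by blast
  qed
  define g where "g k = fst (s k)" for k
  define e where "e k = snd (s k)" for k
  have sk: "s k = (g k, e k)" for k by (simp add: g_def e_def)
  have gc: "g k \<in> cont_maps X" for k using s(1)[of k] by (simp add: sk good_def)
  have epos: "0 < e k x" "e k x \<le> 1" if "x \<in> topspace X" for k x
    using s(1)[of k] that by (auto simp: sk good_def continuous_map_unit_iff)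
  have step: "dist (g (Suc k) x) (g k x) \<le> e k x - e (Suc k) x" "e (Suc k) x \<le> e k x / 2" if "x \<in> topspace X" for k x
    using s(3)[of k] that by (auto simp: sk R_def)
  have inW: "l \<in> W k" if "l \<in> cont_maps X" "\<And>x. x \<in> topspace X \<Longrightarrow> dist (l x) (g (Suc k) x) \<le> e (Suc k) x" for l k
    using s(3)[of k] that by (auto simp: sk R_def)
  have tele: "dist (g (k + j) x) (g k x) \<le> e k x - e (k + j) x" if x: "x \<in> topspace X" for k j x
  proof (induction j)
    case (Suc j)
    then show ?case using step(1)[OF x, of "k + j"] dist_triangle[of "g (k + Suc j) x" "g k x" "g (k + j) x"] by simp
  qed simp
  have esmall: "e k x \<le> (1/2) ^ k" if x: "x \<in> topspace X" for k x
  proof (induction k)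
    case 0 then show ?case using epos[OF x] by simp
  next
    case (Suc k) then show ?case using step(2)[OF x, of k] by simp
  qed
  have close: "dist (g j x) (g k x) \<le> e k x" if "x \<in> topspace X" "k \<le> j" for j k x
    using tele[OF that(1), of k "j - k"] that(2) epos(1)[OF that(1), of j] by simp
  obtain l where l: "continuous_map X euclidean l"
     "\<And>\<epsilon>. 0 < \<epsilon> \<Longrightarrow> \<forall>\<^sub>F n in sequentially. \<forall>x\<in>topspace X. dist (g n x) (l x) < \<epsilon>"
  proof (rule Met_TC.continuous_map_uniformly_Cauchy_limit[of X g])
    show "Met_TC.mcomplete TYPE('m)" by (simp add: complete_UNIV)
    show "\<forall>\<^sub>F n in sequentially. continuous_map X Met_TC.mtopology (g n)" using gc by (simp add: cont_maps_def)
    fix \<epsilon> :: real assume "0 < \<epsilon>"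
    then obtain N where N: "(1/2) ^ N < \<epsilon> / 2" using real_arch_pow_inv[of "\<epsilon> / 2" "1/2"] by auto
    have "dist (g m x) (g n x) < \<epsilon>" if "N \<le> m" "N \<le> n" "x \<in> topspace X" for m n x
      using close[OF that(3,1)] close[OF that(3,2)] esmall[OF that(3), of N] N
        dist_triangle2[of "g m x" "g n x" "g N x"] by linarith
    then show "\<exists>N. \<forall>m n x. N \<le> m \<longrightarrow> N \<le> n \<longrightarrow> x \<in> topspace X \<longrightarrow> dist (g m x) (g n x) < \<epsilon>" by blast
  qed (auto simp: that)
  define l' where "l' = restrict l (topspace X)"
  have "continuous_map X euclidean l'" using l(1) by (rule continuous_map_eq) (simp add: l'_def)
  then have l'c: "l' \<in> cont_maps X" by (simp add: cont_maps_def l'_def)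
  have lim: "dist (l' x) (g k x) \<le> e k x" if x: "x \<in> topspace X" for x k
  proof -
    have "(\<lambda>n. g n x) \<longlonglongrightarrow> l x"
      unfolding tendsto_iff
    proof (intro allI impI)
      fix \<eta> :: real assume "0 < \<eta>"
      from l(2)[OF this] show "\<forall>\<^sub>F n in sequentially. dist (g n x) (l x) < \<eta>"
        by (rule eventually_mono) (use x in blast)
    qed
    then have "(\<lambda>n. dist (g n x) (g k x)) \<longlonglongrightarrow> dist (l x) (g k x)" by (intro tendsto_dist) auto
    then have "dist (l x) (g k x) \<le> e k x"
      using close[OF x] by (intro tendsto_upperbound[of _ _ sequentially]) (auto simp: eventually_sequentially)
    then show ?thesis using x by (simp add: l'_def)
  qed
  have "l' \<in> W k" for k using inW[OF l'c] lim by blast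
  moreover have "l' \<in> sl_ball X h \<epsilon>"
  proof -
    have g0: "g 0 = h" "e 0 = (\<lambda>x. \<epsilon> x / 2)" using s(2) by (auto simp: sk)
    have "dist (l' x) (h x) < \<epsilon> x" if x: "x \<in> topspace X" for x
      using lim[OF x, of 0] \<epsilon> x by (force simp: g0 continuous_map_unit_iff)
    then show ?thesis using l'c by (simp add: sl_ball_def)
  qed
  ultimately show ?thesis by blast
qed

section \<open>Perfect maps\<close>

locale perfect_metric_map = X: Metric_space MX dX + Y: Metric_space MY dY
  for MX :: "'a set" and dX and MY :: "'b set" and dY +
  fixes f :: "'a \<Rightarrow> 'b"
  assumes cont: "continuous_map X.mtopology Y.mtopology f"
    and proper: "proper_map X.mtopology Y.mtopology f"
begin

abbreviation "fib \<equiv> fiber X.mtopology f"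

lemma f_in [simp]: "x \<in> MX \<Longrightarrow> f x \<in> MY"
  using cont by (auto simp: continuous_map_def Pi_iff)

lemma in_fib [simp]: "x \<in> fib y \<longleftrightarrow> x \<in> MX \<and> f x = y"
  by (simp add: fiber_def)

lemma compactin_fib: "y \<in> MY \<Longrightarrow> compactin X.mtopology (fib y)"
  using proper by (simp add: proper_map_def fiber_def)

text \<open>The values together with their limit form a compact set, and its preimage under a proper
  map is compact. A subsequence therefore converges, by continuity to a point over
  \<open>y\<close>.\<close>

lemma convergent_lift:
  assumes x: "\<And>j. x j \<in> MX" and lim: "limitin Y.mtopology (\<lambda>j. f (x j)) y sequentially"
  obtains r a where "strict_mono (r :: nat \<Rightarrow> nat)" "a \<in> fib y" "limitin X.mtopology (x \<circ> r) a sequentially"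
proof -
  have "compactin Y.mtopology (insert y (range (\<lambda>j. f (x j))))"
    using compactin_sequence_with_limit[OF lim, of "range (\<lambda>j. f (x j))"] f_in[OF x] by auto
  then have "compactin X.mtopology {u \<in> topspace X.mtopology. f u \<in> insert y (range (\<lambda>j. f (x j)))}"
    using compactin_proper_map_preimage[OF proper] by blast
  moreover have "range x \<subseteq> {u \<in> topspace X.mtopology. f u \<in> insert y (range (\<lambda>j. f (x j)))}"
    using x by auto
  ultimately obtain a r where ar: "a \<in> MX" "strict_mono r" "limitin X.mtopology (x \<circ> r) a sequentially"
    unfolding X.compactin_sequentially by (metis (no_types, lifting) subsetD)
  have "limitin Y.mtopology (f \<circ> (x \<circ> r)) (f a) sequentially"
    using continuous_map_limit[OF cont ar(3)] .
  moreover have "limitin Y.mtopology (f \<circ> (x \<circ> r)) y sequentially"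
    using limitin_subsequence[OF ar(2) lim] by (simp add: o_def)
  ultimately have "f a = y" using Y.limitin_metric_unique by force
  then show ?thesis using that ar by auto
qed

text \<open>The set \<open>D\<^sub>k\<close>. Bounding the distance below instead of asking for
  distinct points makes the condition closed; \<open>collinear\<close> expresses the line through
  \<open>z\<close> when \<open>z\<close> is off the image of the fiber.\<close>

definition pairs :: "nat \<Rightarrow> ('a \<Rightarrow> 'm::euclidean_space) \<Rightarrow> 'b \<Rightarrow> 'm \<Rightarrow> ('m \<times> 'm) set" where
  "pairs k g y z = {(g x1, g x2) | x1 x2. x1 \<in> fib y \<and> x2 \<in> fib y \<and> inverse (real (Suc k)) \<le> dX x1 x2 \<and>
      collinear {g x1, z, g x2}}"

text \<open>One limit argument for the compactness of \<open>pairs\<close> and for its upper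
  semicontinuity in \<open>y\<close>, \<open>z\<close> and \<open>g\<close> together. The
  \<open>h j\<close> are arbitrary functions, tied to \<open>g\<close> only at the chosen
  points.\<close>

lemma pairs_limit:
  fixes g :: "'a \<Rightarrow> 'm::euclidean_space"
  assumes g: "continuous_map X.mtopology euclidean g"
    and x: "\<And>j. x1 j \<in> MX" "\<And>j. x2 j \<in> MX" "\<And>j. f (x1 j) = y j" "\<And>j. f (x2 j) = y j"
       "\<And>j. inverse (real (Suc k)) \<le> dX (x1 j) (x2 j)" "\<And>j. collinear {h j (x1 j), z j, h j (x2 j)}"
    and lim: "limitin Y.mtopology y y0 sequentially" "z \<longlonglongrightarrow> z0"
    and h: "(\<lambda>j. dist (h j (x1 j)) (g (x1 j))) \<longlonglongrightarrow> 0" "(\<lambda>j. dist (h j (x2 j)) (g (x2 j))) \<longlonglongrightarrow> 0"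
  obtains r p where "strict_mono (r :: nat \<Rightarrow> nat)" "p \<in> pairs k g y0 z0"
    "(\<lambda>j. (h (r j) (x1 (r j)), h (r j) (x2 (r j)))) \<longlonglongrightarrow> p"
proof -
  have l1: "limitin Y.mtopology (\<lambda>j. f (x1 j)) y0 sequentially" using lim x(3) by simp
  obtain r a where r: "strict_mono r" "a \<in> fib y0" "limitin X.mtopology (x1 \<circ> r) a sequentially"
    using convergent_lift[OF x(1) l1] .
  have l2: "limitin Y.mtopology (\<lambda>j. f ((x2 \<circ> r) j)) y0 sequentially"
    using limitin_subsequence[OF r(1) lim(1)] x(4) by (simp add: o_def)
  obtain s b where s: "strict_mono s" "b \<in> fib y0" "limitin X.mtopology (x2 \<circ> r \<circ> s) b sequentially"
    using convergent_lift[OF _ l2] x(2) by (metis comp_apply)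
  define t where "t = r \<circ> s"
  have t: "strict_mono t" using r(1) s(1) by (simp add: t_def strict_mono_o)
  have a: "limitin X.mtopology (x1 \<circ> t) a sequentially"
    using limitin_subsequence[OF s(1) r(3)] by (simp add: t_def o_assoc)
  have b: "limitin X.mtopology (x2 \<circ> t) b sequentially" using s(3) by (simp add: t_def o_assoc)
  have glim: "(\<lambda>j. h (t j) (u (t j))) \<longlonglongrightarrow> g c"
    if u: "limitin X.mtopology (u \<circ> t) c sequentially" and hu: "(\<lambda>j. dist (h j (u j)) (g (u j))) \<longlonglongrightarrow> 0" for u c
  proof -
    have "limitin euclidean (g \<circ> (u \<circ> t)) (g c) sequentially" using continuous_map_limit[OF g u] .
    then have 1: "(\<lambda>j. g (u (t j))) \<longlonglongrightarrow> g c" by (simp add: o_def)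
    have "(\<lambda>j. dist (h (t j) (u (t j))) (g (u (t j)))) \<longlonglongrightarrow> 0"
      using LIMSEQ_subseq_LIMSEQ[OF hu t] by (simp add: o_def)
    then have "(\<lambda>j. h (t j) (u (t j)) - g (u (t j))) \<longlonglongrightarrow> 0"
      by (simp add: dist_norm tendsto_norm_zero_iff)
    from tendsto_add[OF this 1] show ?thesis by simp
  qed
  have ga: "(\<lambda>j. h (t j) (x1 (t j))) \<longlonglongrightarrow> g a" using glim[OF a h(1)] .
  have gb: "(\<lambda>j. h (t j) (x2 (t j))) \<longlonglongrightarrow> g b" using glim[OF b h(2)] .
  have zt: "(\<lambda>j. z (t j)) \<longlonglongrightarrow> z0" using LIMSEQ_subseq_LIMSEQ[OF lim(2) t] by (simp add: o_def)
  have "(\<lambda>j. (h (t j) (x1 (t j)), z (t j), h (t j) (x2 (t j)))) \<longlonglongrightarrow> (g a, z0, g b)"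
    by (intro tendsto_Pair ga zt gb)
  then have "(g a, z0, g b) \<in> {(x, y, z). collinear {x, y, z}}"
    by (rule closed_sequentially[OF closed_collinear, rotated]) (use x(6) in simp)
  moreover have "inverse (real (Suc k)) \<le> dX a b"
  proof (rule field_le_epsilon)
    fix e :: real assume e: "0 < e"
    have "\<forall>\<^sub>F j in sequentially. dX ((x1 \<circ> t) j) a < e / 2" "\<forall>\<^sub>F j in sequentially. dX ((x2 \<circ> t) j) b < e / 2"
      using conjunct2[OF a[unfolded X.limitin_metric], rule_format, of "e / 2"]
        conjunct2[OF b[unfolded X.limitin_metric], rule_format, of "e / 2"] e
      by (auto elim: eventually_mono)
    then have "\<forall>\<^sub>F j in sequentially. dX (x1 (t j)) a < e / 2 \<and> dX (x2 (t j)) b < e / 2"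
      by (simp add: eventually_conj)
    then obtain j where j: "dX (x1 (t j)) a < e / 2" "dX (x2 (t j)) b < e / 2"
      by (auto simp: eventually_sequentially)
    have M: "a \<in> MX" "b \<in> MX" using r s by auto
    have "dX (x1 (t j)) (x2 (t j)) \<le> dX (x1 (t j)) a + dX a b + dX (x2 (t j)) b"
      using X.triangle[of "x1 (t j)" a "x2 (t j)"] X.triangle'[of a b "x2 (t j)"] M x(1,2) by (smt (verit))
    then show "inverse (real (Suc k)) \<le> dX a b + e" using j x(5)[of "t j"] by linarith
  qed
  ultimately have "(g a, g b) \<in> pairs k g y0 z0" using r s unfolding pairs_def by blast
  then show ?thesis using that[OF t _ tendsto_Pair[OF ga gb]] by blast
qed

lemma compact_pairs:
  fixes g :: "'a \<Rightarrow> 'm::euclidean_space"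
  assumes g: "continuous_map X.mtopology euclidean g" and y: "y \<in> MY"
  shows "compact (pairs k g y z)"
  unfolding compact_def
proof (intro allI impI)
  fix p :: "nat \<Rightarrow> 'm \<times> 'm" assume "\<forall>j. p j \<in> pairs k g y z"
  then have "\<forall>j. \<exists>x1 x2. p j = (g x1, g x2) \<and> x1 \<in> fib y \<and> x2 \<in> fib y \<and> inverse (real (Suc k)) \<le> dX x1 x2 \<and>
      collinear {g x1, z, g x2}" unfolding pairs_def by blast
  then obtain x1 x2 where x: "\<And>j. p j = (g (x1 j), g (x2 j)) \<and> x1 j \<in> fib y \<and> x2 j \<in> fib y \<and> inverse (real (Suc k)) \<le> dX (x1 j) (x2 j) \<and>
      collinear {g (x1 j), z, g (x2 j)}" by metis
  obtain r q where "strict_mono r" "q \<in> pairs k g y z" "(\<lambda>j. (g (x1 (r j)), g (x2 (r j)))) \<longlonglongrightarrow> q"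
  proof (rule pairs_limit[of g x1 x2 "\<lambda>_. y" k "\<lambda>_. g" "\<lambda>_. z" y z])
    show "limitin Y.mtopology (\<lambda>_. y) y sequentially" using y by (simp add: Y.limitin_metric)
  qed (use g x in auto)
  then show "\<exists>l\<in>pairs k g y z. \<exists>r. strict_mono r \<and> (p \<circ> r) \<longlonglongrightarrow> l"
    using x by (auto simp: o_def)
qed

text \<open>Required for all \<open>k\<close>, this characterises the maps of the theorem. Here
  \<open>z\<close> may run to infinity or approach the image, which obstructs openness;
  \<open>good_at\<close> therefore bounds the norm of \<open>z\<close> and keeps it away from the
  image.\<close>

definition good_level :: "nat \<Rightarrow> ('a \<Rightarrow> 'm::euclidean_space) \<Rightarrow> bool" where
  "good_level k g \<longleftrightarrow> (\<forall>y\<in>MY. \<forall>z. z \<notin> g ` fib y \<longrightarrow> small_pieces (inverse (real (Suc k))) (pairs k g y z))"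

text \<open>The margin between \<open>z\<close> and \<open>g\<close> is imposed over a whole
  ball around \<open>y\<close>, since the fibers vary only upper semicontinuously.\<close>

definition good_at :: "nat \<Rightarrow> ('a \<Rightarrow> 'm::euclidean_space) \<Rightarrow> 'b \<Rightarrow> bool" where
  "good_at k g y \<longleftrightarrow> (\<forall>z. norm z \<le> real k \<and>
      (\<forall>x\<in>MX. dY (f x) y < inverse (real (Suc k)) \<longrightarrow> inverse (real (Suc k)) \<le> dist (g x) z)
      \<longrightarrow> small_pieces (inverse (real (Suc k))) (pairs k g y z))"

text \<open>The slack \<open>dY (f x) y'\<close> lets the condition pass from \<open>y\<close> to a point at distance \<open>s\<close> with
  \<open>r - s\<close> in place of \<open>r\<close>, so that the supremum of the radii is a Lipschitz function of \<open>y\<close>.\<close>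

definition stable_radius :: "nat \<Rightarrow> ('a \<Rightarrow> 'm::euclidean_space) \<Rightarrow> 'b \<Rightarrow> real \<Rightarrow> bool" where
  "stable_radius k g y r \<longleftrightarrow> (\<forall>y'\<in>MY. dY y y' < r \<longrightarrow>
      (\<forall>h. (\<forall>x\<in>MX. dist (h x) (g x) < r + dY (f x) y') \<longrightarrow> good_at k h y'))"

section \<open>Stability of smallness under changes of fiber, point and map\<close>

lemma small_pieces_stable:
  fixes g :: "'a \<Rightarrow> 'm::euclidean_space"
  assumes g: "continuous_map X.mtopology euclidean g"
    and sp: "small_pieces \<epsilon> (pairs k g y0 z0)"
    and lim: "limitin Y.mtopology y y0 sequentially" "z \<longlonglongrightarrow> z0" "t \<longlonglongrightarrow> 0"
    and h: "\<And>j x. x \<in> fib (y j) \<Longrightarrow> dist (h j x) (g x) \<le> t j"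
  shows "\<exists>j::nat. small_pieces \<epsilon> (pairs k (h j) (y j) (z j))"
proof (rule ccontr)
  assume neg: "\<nexists>j. small_pieces \<epsilon> (pairs k (h j) (y j) (z j))"
  obtain \<V> where V: "\<forall>V\<in>\<V>. open V \<and> (\<forall>p\<in>V. \<forall>q\<in>V. dist p q < \<epsilon>)" "pairwise disjnt \<V>" "pairs k g y0 z0 \<subseteq> \<Union>\<V>"
    using sp unfolding small_pieces_def by blast
  have "\<not> pairs k (h j) (y j) (z j) \<subseteq> \<Union>\<V>" for j
    using neg V(1,2) unfolding small_pieces_def by blast
  then have "\<forall>j. \<exists>x1 x2. x1 \<in> fib (y j) \<and> x2 \<in> fib (y j) \<and> inverse (real (Suc k)) \<le> dX x1 x2 \<and>
      collinear {h j x1, z j, h j x2} \<and> (h j x1, h j x2) \<notin> \<Union>\<V>" unfolding pairs_def by blast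
  then obtain x1 x2 where x: "\<And>j. x1 j \<in> fib (y j)" "\<And>j. x2 j \<in> fib (y j)" "\<And>j. inverse (real (Suc k)) \<le> dX (x1 j) (x2 j)"
      "\<And>j. collinear {h j (x1 j), z j, h j (x2 j)}" "\<And>j. (h j (x1 j), h j (x2 j)) \<notin> \<Union>\<V>" by metis
  have small: "(\<lambda>j. dist (h j (u j)) (g (u j))) \<longlonglongrightarrow> 0" if "\<And>j. u j \<in> fib (y j)" for u
    by (rule tendsto_sandwich[OF _ _ tendsto_const lim(3)]) (use h that in auto)
  obtain r p where r: "strict_mono r" "p \<in> pairs k g y0 z0" "(\<lambda>j. (h (r j) (x1 (r j)), h (r j) (x2 (r j)))) \<longlonglongrightarrow> p"
  proof (rule pairs_limit[of g x1 x2 y k h z y0 z0])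
    show "(\<lambda>j. dist (h j (x1 j)) (g (x1 j))) \<longlonglongrightarrow> 0" "(\<lambda>j. dist (h j (x2 j)) (g (x2 j))) \<longlonglongrightarrow> 0"
      using small x(1,2) by blast+
  qed (use g x lim in auto)
  \<comment> \<open>The limit pair lies in the open set \<open>\<Union>\<V>\<close>, which all
    approximating pairs avoid.\<close>
  have "open (\<Union>\<V>)" "p \<in> \<Union>\<V>" using V r(2) by auto
  then have "\<forall>\<^sub>F j in sequentially. (h (r j) (x1 (r j)), h (r j) (x2 (r j))) \<in> \<Union>\<V>"
    using r(3) topological_tendstoD by blast
  then show False using x(5) by (auto simp: eventually_sequentially)
qed

text \<open>If all radii \<open>1 / (j + 1)\<close> fail, there are \<open>y j\<close> tending to
  \<open>y0\<close>, maps approaching \<open>g\<close> on the fibers over \<open>y j\<close>, and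
  \<open>z j\<close> of norm at most \<open>k\<close>, hence with a convergent subsequence. The
  margin keeps the limit \<open>z0\<close> off the image of the fiber over \<open>y0\<close>, so
  smallness holds there and persists.\<close>

lemma stable_radius_exists:
  fixes g :: "'a \<Rightarrow> 'm::euclidean_space"
  assumes g: "continuous_map X.mtopology euclidean g" and good: "good_level k g" and y0: "y0 \<in> MY"
  shows "\<exists>r>0. r \<le> 1 \<and> stable_radius k g y0 r"
proof (rule ccontr)
  assume neg: "\<nexists>r. r > 0 \<and> r \<le> 1 \<and> stable_radius k g y0 r"
  define t where "t j = inverse (real (Suc j))" for j
  have t: "0 < t j" "t j \<le> 1" for j by (auto simp: t_def field_simps)
  have t0: "t \<longlonglongrightarrow> 0" unfolding t_def[abs_def] by (rule LIMSEQ_inverse_real_of_nat)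
  have "\<forall>j. \<exists>y h z. y \<in> MY \<and> dY y0 y < t j \<and> (\<forall>x\<in>MX. dist (h x) (g x) < t j + dY (f x) y) \<and> norm z \<le> real k \<and>
      (\<forall>x\<in>MX. dY (f x) y < inverse (real (Suc k)) \<longrightarrow> inverse (real (Suc k)) \<le> dist (h x) z) \<and>
      \<not> small_pieces (inverse (real (Suc k))) (pairs k h y z)"
  proof
    fix j
    have "\<not> stable_radius k g y0 (t j)" using neg t by blast
    then show "\<exists>y h z. y \<in> MY \<and> dY y0 y < t j \<and> (\<forall>x\<in>MX. dist (h x) (g x) < t j + dY (f x) y) \<and> norm z \<le> real k \<and>
      (\<forall>x\<in>MX. dY (f x) y < inverse (real (Suc k)) \<longrightarrow> inverse (real (Suc k)) \<le> dist (h x) z) \<and>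
      \<not> small_pieces (inverse (real (Suc k))) (pairs k h y z)"
      unfolding stable_radius_def good_at_def by blast
  qed
  then obtain y h z where yhz: "\<And>j. y j \<in> MY" "\<And>j. dY y0 (y j) < t j"
      "\<And>j x. x \<in> MX \<Longrightarrow> dist (h j x) (g x) < t j + dY (f x) (y j)" "\<And>j. norm (z j) \<le> real k"
      "\<And>j x. x \<in> MX \<Longrightarrow> dY (f x) (y j) < inverse (real (Suc k)) \<Longrightarrow> inverse (real (Suc k)) \<le> dist (h j x) (z j)"
      "\<And>j. \<not> small_pieces (inverse (real (Suc k))) (pairs k (h j) (y j) (z j))"
    by metis
  have "bounded (range z)" using yhz(4) by (auto simp: bounded_iff)
  then obtain z0 s where s: "strict_mono s" "(z \<circ> s) \<longlonglongrightarrow> z0"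
    using bounded_imp_convergent_subsequence by blast
  have ts0: "(\<lambda>j. t (s j)) \<longlonglongrightarrow> 0" using LIMSEQ_subseq_LIMSEQ[OF t0 s(1)] by (simp add: o_def)
  have zs: "(\<lambda>j. z (s j)) \<longlonglongrightarrow> z0" using s(2) by (simp add: o_def)
  \<comment> \<open>The margin for \<open>h (s j)\<close> extends to all fibers near
    \<open>y (s j)\<close>, among them the one over \<open>y0\<close>. On that fiber
    \<open>h (s j)\<close> is within \<open>2 * t (s j)\<close> of \<open>g\<close>.\<close>
  have "z0 \<notin> g ` fib y0"
  proof
    assume "z0 \<in> g ` fib y0"
    then obtain x where x: "x \<in> MX" "f x = y0" "z0 = g x" by auto
    have "(\<lambda>j. dist (z (s j)) z0 + 2 * t (s j)) \<longlonglongrightarrow> 0"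
      using tendsto_add[OF tendsto_dist[OF zs tendsto_const[of z0]] tendsto_mult[OF tendsto_const[of 2] ts0]] by simp
    then have "\<forall>\<^sub>F j in sequentially. dist (z (s j)) z0 + 2 * t (s j) < inverse (real (Suc k))"
      by (rule order_tendstoD(2)) simp
    then obtain j where j: "dist (z (s j)) z0 + 2 * t (s j) < inverse (real (Suc k))"
      by (auto simp: eventually_sequentially)
    have "dY (f x) (y (s j)) < inverse (real (Suc k))"
      using yhz(2)[of "s j"] j t(1)[of "s j"] zero_le_dist[of "z (s j)" z0] unfolding x(2) by linarith
    then have "inverse (real (Suc k)) \<le> dist (h (s j) x) (z (s j))" using yhz(5) x(1) by blast
    moreover have "dist (h (s j) x) (g x) < 2 * t (s j)" using yhz(3)[OF x(1), of "s j"] yhz(2)[of "s j"] x(2) by simp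
    ultimately show False
      using j x(3) dist_triangle[of "h (s j) x" "z (s j)" z0] by (simp add: dist_commute)
  qed
  then have sp: "small_pieces (inverse (real (Suc k))) (pairs k g y0 z0)" using good y0 by (simp add: good_level_def)
  have "limitin Y.mtopology (\<lambda>j. y (s j)) y0 sequentially"
    unfolding Y.limitin_metric
  proof (intro conjI allI impI)
    fix e :: real assume "0 < e"
    then have "\<forall>\<^sub>F j in sequentially. t (s j) < e" using order_tendstoD(2)[OF ts0] by blast
    then show "\<forall>\<^sub>F j in sequentially. y (s j) \<in> MY \<and> dY (y (s j)) y0 < e"
      by (rule eventually_mono) (use yhz(1,2) Y.commute in \<open>metis order_less_trans\<close>)
  qed (rule y0)
  then have "\<exists>j. small_pieces (inverse (real (Suc k))) (pairs k (h (s j)) (y (s j)) (z (s j)))"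
  proof (rule small_pieces_stable[OF g sp _ zs ts0])
    show "dist (h (s j) x) (g x) \<le> t (s j)" if "x \<in> fib (y (s j))" for j x
      using yhz(3)[of x "s j"] that yhz(1)[of "s j"] by auto
  qed
  then show False using yhz(6) by blast
qed

text \<open>A single function on \<open>X\<close> has to work for all \<open>y\<close>: half the
  supremum of the stable radii, composed with \<open>f\<close>. It is continuous because this
  supremum is Lipschitz on \<open>Y\<close>.\<close>

lemma stable_neighbourhood:
  fixes g :: "'a \<Rightarrow> 'm::euclidean_space"
  assumes g: "g \<in> cont_maps X.mtopology" and good: "good_level k g"
  obtains \<epsilon> where "continuous_map X.mtopology (top_of_set {0<..1}) \<epsilon>"
    "\<And>h y. h \<in> sl_ball X.mtopology g \<epsilon> \<Longrightarrow> y \<in> MY \<Longrightarrow> good_at k h y"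
proof -
  have gc: "continuous_map X.mtopology euclidean g" using g by (simp add: cont_maps_def)
  let ?R = "stable_radius k g"
  have R0: "?R y 0" if "y \<in> MY" for y
    unfolding stable_radius_def using Y.nonneg[of y] by (meson not_less)
  have R: "?R y' (r - dY y y')" if y: "y \<in> MY" "y' \<in> MY" and r: "?R y r" for y y' r
    unfolding stable_radius_def
  proof (intro ballI impI allI)
    fix u h assume u: "u \<in> MY" "dY y' u < r - dY y y'" and h: "\<forall>x\<in>MX. dist (h x) (g x) < r - dY y y' + dY (f x) u"
    have "dY y u < r" using Y.triangle[of y y' u] u y by linarith
    moreover have "\<forall>x\<in>MX. dist (h x) (g x) < r + dY (f x) u"
      using h Y.nonneg[of y y'] by (smt (verit))
    ultimately show "good_at k h u" using r u(1) unfolding stable_radius_def by blast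
  qed
  define \<rho> where "\<rho> = Y.radius ?R"
  have \<rho>c: "continuous_map Y.mtopology euclideanreal \<rho>"
    unfolding \<rho>_def by (rule Y.continuous_map_radius) (use R0 R in auto)
  have \<rho>lip: "\<rho> y \<le> \<rho> y' + dY y y'" if "y \<in> MY" "y' \<in> MY" for y y'
    unfolding \<rho>_def by (rule Y.radius_lipschitz) (use R0 R that in auto)
  have \<rho>1: "0 < \<rho> y" "\<rho> y \<le> 1" if y: "y \<in> MY" for y
  proof -
    obtain r where "r > 0" "r \<le> 1" "?R y r" using stable_radius_exists[OF gc good y] by blast
    then show "0 < \<rho> y" using Y.radius_upper[of r ?R y] by (simp add: \<rho>_def)
    show "\<rho> y \<le> 1" unfolding \<rho>_def using R0[OF y] by (rule Y.radius_le_1)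
  qed
  show ?thesis
  proof
    have "continuous_map X.mtopology euclideanreal (\<lambda>x. \<rho> (f x) / 2)"
      using continuous_map_compose[OF cont \<rho>c] by (intro continuous_map_real_divide) (auto simp: o_def)
    moreover have "0 < \<rho> (f x) / 2 \<and> \<rho> (f x) / 2 \<le> 1" if "x \<in> MX" for x
      using \<rho>1[OF f_in[OF that]] by linarith
    ultimately show "continuous_map X.mtopology (top_of_set {0<..1}) (\<lambda>x. \<rho> (f x) / 2)"
      unfolding continuous_map_unit_iff by simp
    fix h y assume h: "h \<in> sl_ball X.mtopology g (\<lambda>x. \<rho> (f x) / 2)" and y: "y \<in> MY"
    obtain r where r: "?R y r" "\<rho> y / 2 < r"
      using Y.radius_greater[of ?R y "\<rho> y / 2"] R0[OF y] \<rho>1[OF y] unfolding \<rho>_def by (metis field_sum_of_halves less_add_same_cancel1 half_gt_zero)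
    \<comment> \<open>By the Lipschitz bound \<open>\<rho> (f x) / 2\<close> exceeds
      \<open>\<rho> y / 2\<close> by at most half of \<open>dY (f x) y\<close>, which the slack in
      \<open>stable_radius\<close> absorbs for \<open>x\<close> off the fiber.\<close>
    have "dist (h x) (g x) < r + dY (f x) y" if x: "x \<in> MX" for x
    proof -
      have "dist (h x) (g x) < \<rho> (f x) / 2" using h x by (simp add: sl_ball_def)
      also have "\<dots> \<le> (\<rho> y + dY (f x) y) / 2" using \<rho>lip[of "f x" y] x y by simp
      also have "\<dots> \<le> r + dY (f x) y" using r(2) Y.nonneg[of "f x" y] by argo
      finally show ?thesis .
    qed
    moreover have "0 < r" using r(2) \<rho>1(1)[OF y] by linarith
    ultimately show "good_at k h y" using r(1) y unfolding stable_radius_def by simp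
  qed
qed

text \<open>For fixed \<open>z\<close> both restrictions in \<open>good_at\<close> hold from some
  level on. If the margin failed at every level, points over values tending to \<open>y\<close>
  would accumulate at a point of the fiber with value \<open>z\<close>.\<close>

lemma eventually_small_pieces:
  fixes g :: "'a \<Rightarrow> 'm::euclidean_space"
  assumes g: "continuous_map X.mtopology euclidean g" and good: "\<And>k. good_at k g y" and y: "y \<in> MY" and z: "z \<notin> g ` fib y"
  shows "\<exists>k0. \<forall>k\<ge>k0. small_pieces (inverse (real (Suc k))) (pairs k g y z)"
proof -
  have "\<exists>k1. \<forall>x\<in>MX. dY (f x) y < inverse (real (Suc k1)) \<longrightarrow> inverse (real (Suc k1)) \<le> dist (g x) z"
  proof (rule ccontr)
    assume "\<not> ?thesis"
    then obtain x where x: "\<And>j. x j \<in> MX" "\<And>j. dY (f (x j)) y < inverse (real (Suc j))" "\<And>j. dist (g (x j)) z < inverse (real (Suc j))"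
      unfolding not_ex not_all bex_simps ball_simps not_imp not_le by metis
    have xy: "limitin Y.mtopology (\<lambda>j. f (x j)) y sequentially"
      unfolding Y.limitin_metric
    proof (intro conjI allI impI)
      fix e :: real assume "0 < e"
      then have "\<forall>\<^sub>F j in sequentially. inverse (real (Suc j)) < e"
        using order_tendstoD(2)[OF LIMSEQ_inverse_real_of_nat] by blast
      then show "\<forall>\<^sub>F j in sequentially. f (x j) \<in> MY \<and> dY (f (x j)) y < e"
        by (rule eventually_mono) (use x(1,2) in \<open>auto intro: order_less_trans\<close>)
    qed (rule y)
    obtain r a where r: "strict_mono r" "a \<in> fib y" "limitin X.mtopology (x \<circ> r) a sequentially"
      by (rule convergent_lift[OF x(1) xy])
    have "(\<lambda>j. g (x (r j))) \<longlonglongrightarrow> g a" using continuous_map_limit[OF g r(3)] by (simp add: o_def)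
    moreover have "(\<lambda>j. dist (g (x j)) z) \<longlonglongrightarrow> 0"
      by (rule tendsto_sandwich[OF _ _ tendsto_const LIMSEQ_inverse_real_of_nat]) (simp, use x(3) in \<open>meson always_eventually less_imp_le\<close>)
    then have "(\<lambda>j. g (x j)) \<longlonglongrightarrow> z" by (subst tendsto_dist_iff)
    from LIMSEQ_subseq_LIMSEQ[OF this r(1)] have "(\<lambda>j. g (x (r j))) \<longlonglongrightarrow> z" by (simp add: o_def)
    ultimately have "g a = z" using LIMSEQ_unique by blast
    then show False using z r(2) by blast
  qed
  then obtain k1 where k1: "\<And>x. x \<in> MX \<Longrightarrow> dY (f x) y < inverse (real (Suc k1)) \<Longrightarrow> inverse (real (Suc k1)) \<le> dist (g x) z"
    by blast
  obtain k2 :: nat where k2: "norm z \<le> real k2" using real_arch_simple by blast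
  show ?thesis
  proof (intro exI[of _ "max k1 k2"] allI impI)
    fix k assume k: "max k1 k2 \<le> k"
    have kk: "inverse (real (Suc k)) \<le> inverse (real (Suc k1))" using k by (simp add: field_simps)
    have "norm z \<le> real k" using k2 k by simp
    moreover have "\<forall>x\<in>MX. dY (f x) y < inverse (real (Suc k)) \<longrightarrow> inverse (real (Suc k)) \<le> dist (g x) z"
      using k1 kk by (meson order_less_le_trans order_trans)
    ultimately show "small_pieces (inverse (real (Suc k))) (pairs k g y z)"
      using good[of k] by (simp add: good_at_def)
  qed
qed

section \<open>The set of the theorem as an increasing union of compact sets\<close>

lemma pairs_mono:
  assumes "j \<le> k"
  shows "pairs j g y z \<subseteq> pairs k g y z"
proof -
  have "inverse (real (Suc k)) \<le> inverse (real (Suc j))" using assms by (simp add: field_simps)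
  then show ?thesis unfolding pairs_def by (blast intro: order_trans)
qed

text \<open>Distinct points have distance at least \<open>1 / (k + 1)\<close> for some
  \<open>k\<close>. As \<open>z\<close> is no value of \<open>g\<close> on the fiber, lines through
  \<open>z\<close> translate into collinearity.\<close>

lemma D21_eq:
  fixes g :: "'a \<Rightarrow> real^'m"
  assumes z: "z \<notin> g ` fib y"
  shows "D21 (fib y) g z = (\<Union>k. pairs k g y z)"
proof -
  have line: "(\<exists>L. affine L \<and> aff_dim L = 1 \<and> z \<in> L \<and> g x1 \<in> L \<and> g x2 \<in> L) \<longleftrightarrow> collinear {g x1, z, g x2}"
    if "x2 \<in> fib y" for x1 x2
    using that z by (intro ex_line_iff_collinear) blast
  show ?thesis
  proof (intro equalityI subsetI)
    fix p assume "p \<in> D21 (fib y) g z"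
    then obtain x1 x2 where p: "p = (g x1, g x2)" and x: "x1 \<in> fib y" "x2 \<in> fib y" "x1 \<noteq> x2"
      and "\<exists>L. affine L \<and> aff_dim L = 1 \<and> z \<in> L \<and> g x1 \<in> L \<and> g x2 \<in> L"
      unfolding D21_def by blast
    then have col: "collinear {g x1, z, g x2}" using line by blast
    have "0 < dX x1 x2" using x by auto
    then obtain k where "inverse (real (Suc k)) < dX x1 x2" using reals_Archimedean by blast
    then show "p \<in> (\<Union>k. pairs k g y z)"
      using p x col unfolding pairs_def by (blast intro: less_imp_le)
  next
    fix p assume "p \<in> (\<Union>k. pairs k g y z)"
    then obtain k x1 x2 where p: "p = (g x1, g x2)" and x: "x1 \<in> fib y" "x2 \<in> fib y"
      and d: "inverse (real (Suc k)) \<le> dX x1 x2" and col: "collinear {g x1, z, g x2}"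
      unfolding pairs_def by blast
    have "0 < inverse (real (Suc k))" by simp
    then have "0 < dX x1 x2" using d by (rule less_le_trans)
    then have "x1 \<noteq> x2" using x by auto
    moreover have "\<exists>L. affine L \<and> aff_dim L = 1 \<and> z \<in> L \<and> g x1 \<in> L \<and> g x2 \<in> L"
      using line[OF x(2)] col by blast
    ultimately show "p \<in> D21 (fib y) g z" unfolding D21_def p using x by blast
  qed
qed

lemma small_pieces_if_dim_D21_le_0:
  fixes g :: "'a \<Rightarrow> real^'m"
  assumes g: "continuous_map X.mtopology euclidean g" and y: "y \<in> MY" and z: "z \<notin> g ` fib y"
    and dim: "covering_dim (top_of_set (D21 (fib y) g z)) \<le> 0"
  shows "small_pieces (inverse (real (Suc k))) (pairs k g y z)"
proof -
  let ?D = "D21 (fib y) g z"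
  have dim': "covering_dim_at_most (top_of_set ?D) 0"
    using dim covering_dim_le_iff[of "top_of_set ?D" 0] by (simp flip: zero_ereal_def)
  have "compact (g ` fib y)"
    using image_compactin[OF compactin_fib[OF y] g] by simp
  then have "bounded (g ` fib y \<times> g ` fib y)" by (intro bounded_Times compact_imp_bounded)
  then have "bounded ?D" by (rule bounded_subset) (auto simp: D21_def)
  then have "small_pieces (inverse (real (Suc k))) ?D"
    using zero_dim_imp_small_pieces[OF dim'] by simp
  then show ?thesis by (rule small_pieces_mono) (use D21_eq[OF z] in auto)
qed

text \<open>Level \<open>l\<close> controls only the scale \<open>1 / (l + 1)\<close>. But
  \<open>pairs k\<close> lies in \<open>pairs l\<close> for all \<open>l \<ge> k\<close>, so letting
  \<open>l\<close> grow makes the compact set \<open>pairs k\<close> small at every scale; the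
  countable sum theorem finishes.\<close>

lemma dim_D21_le_0:
  fixes g :: "'a \<Rightarrow> real^'m"
  assumes g: "continuous_map X.mtopology euclidean g" and y: "y \<in> MY" and z: "z \<notin> g ` fib y"
    and sp: "\<And>k. k0 \<le> k \<Longrightarrow> small_pieces (inverse (real (Suc k))) (pairs k g y z)"
  shows "covering_dim (top_of_set (D21 (fib y) g z)) \<le> 0"
proof -
  let ?D = "D21 (fib y) g z"
  have "covering_dim_at_most (top_of_set (pairs k g y z)) 0" for k
    using compact_pairs[OF g y]
  proof (rule small_pieces_imp_zero_dim)
    fix e :: real assume "0 < e"
    then obtain j where j: "inverse (real (Suc j)) < e" using reals_Archimedean by blast
    define l where "l = max (max j k) k0"
    have l: "j \<le> l" "k \<le> l" "k0 \<le> l" by (auto simp: l_def)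
    have "inverse (real (Suc l)) \<le> inverse (real (Suc j))" using l(1) by (simp add: field_simps)
    then show "small_pieces e (pairs k g y z)"
      using small_pieces_mono[OF sp[OF l(3)] pairs_mono[OF l(2)]] j by (meson less_imp_le order_trans)
  qed
  moreover have sub: "pairs k g y z \<subseteq> ?D" for k using D21_eq[OF z] by blast
  ultimately have "covering_dim_at_most (subtopology (top_of_set ?D) (pairs k g y z)) 0" for k
    by (simp add: subtopology_subtopology inf.absorb2)
  moreover have "closedin (top_of_set ?D) (pairs k g y z)" for k
    using compact_imp_closed[OF compact_pairs[OF g y]] sub by (rule closed_subset[rotated])
  moreover have "normal_space (top_of_set ?D)"
    by (intro metrizable_imp_normal_space metrizable_space_subtopology metrizable_space_euclidean)
  moreover have "(\<Union>k. pairs k g y z) = topspace (top_of_set ?D)" using D21_eq[OF z] by simp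
  ultimately have "covering_dim_at_most (top_of_set ?D) 0"
    using zero_dim_countable_sum[of "top_of_set ?D" "\<lambda>k. pairs k g y z"] by simp
  then show ?thesis
    using covering_dim_le_iff[of "top_of_set ?D" 0] by (simp flip: zero_ereal_def)
qed

text \<open>A nerve map near each fiber solves the problem over a neighbourhood of \<open>y\<close>.
  As \<open>Y\<close> has dimension zero, a partition into open sets refines these neighbourhoods,
  and over disjoint sets the local maps paste automatically.\<close>

lemma good_level_dense:
  fixes g0 :: "'a \<Rightarrow> 'm::euclidean_space"
  assumes dimY: "covering_dim_at_most Y.mtopology 0"
    and dimf: "\<And>y. y \<in> MY \<Longrightarrow> covering_dim_at_most (subtopology X.mtopology (fib y)) (int n)"
    and n: "2 * n + 1 \<le> DIM('m)"
    and g0: "g0 \<in> cont_maps X.mtopology" and \<epsilon>: "continuous_map X.mtopology (top_of_set {0<..1}) \<epsilon>"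
  shows "\<exists>g \<in> sl_ball X.mtopology g0 \<epsilon>. good_level k g"
proof -
  define \<delta> where "\<delta> = inverse (real (Suc k))"
  have \<delta>: "0 < \<delta>" by (simp add: \<delta>_def)
  have g0c: "continuous_map X.mtopology euclidean g0" using g0 by (simp add: cont_maps_def)
  have \<epsilon>c: "continuous_map X.mtopology euclideanreal \<epsilon>" "\<And>x. x \<in> MX \<Longrightarrow> 0 < \<epsilon> x"
    using \<epsilon> by (auto simp: continuous_map_unit_iff)
  \<comment> \<open>Finiteness is required over the whole of \<open>N\<close>, so it holds for every
    fiber over \<open>N\<close> at once and passes to smaller sets.\<close>
  define local_sol where "local_sol N h \<longleftrightarrow>
      continuous_map (subtopology X.mtopology {x \<in> MX. f x \<in> N}) euclidean (h :: 'a \<Rightarrow> 'm) \<and>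
      (\<forall>x\<in>MX. f x \<in> N \<longrightarrow> dist (h x) (g0 x) < \<epsilon> x) \<and>
      (\<forall>z. finite {(h x1, h x2) | x1 x2. x1 \<in> MX \<and> x2 \<in> MX \<and> f x1 \<in> N \<and> f x2 \<in> N \<and> \<delta> \<le> dX x1 x2 \<and>
              h x1 \<noteq> z \<and> h x2 \<noteq> z \<and> collinear {h x1, z, h x2}})" for N h
  have "\<exists>N h. openin Y.mtopology N \<and> y \<in> N \<and> local_sol N h" if y: "y \<in> MY" for y
  proof -
    obtain W h where W: "openin X.mtopology W" "fib y \<subseteq> W" "continuous_map (subtopology X.mtopology W) euclidean (h :: 'a \<Rightarrow> 'm)"
      "\<And>x. x \<in> W \<Longrightarrow> dist (h x) (g0 x) < \<epsilon> x"
      and fin: "\<And>z. finite {(h x1, h x2) | x1 x2. x1 \<in> W \<and> x2 \<in> W \<and> \<delta> \<le> dX x1 x2 \<and>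
              h x1 \<noteq> z \<and> h x2 \<noteq> z \<and> collinear {h x1, z, h x2}}"
    proof (rule X.nerve_map[OF compactin_fib[OF y] dimf[OF y] n g0c \<epsilon>c(1) _ \<delta>])
      show "0 < \<epsilon> x" if "x \<in> MX" for x using \<epsilon>c(2)[OF that] .
    qed (rule that)
    have "closed_map X.mtopology Y.mtopology f" using proper by (simp add: proper_map_def)
    then have "\<exists>N. openin Y.mtopology N \<and> y \<in> N \<and> {x \<in> topspace X.mtopology. f x \<in> N} \<subseteq> W"
      using W(1,2) y unfolding closed_map_fibre_neighbourhood fiber_def by simp
    then obtain N where N: "openin Y.mtopology N" "y \<in> N" "{x \<in> MX. f x \<in> N} \<subseteq> W" by auto
    have "local_sol N h"
      unfolding local_sol_def
    proof (intro conjI ballI impI allI)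
      show "continuous_map (subtopology X.mtopology {x \<in> MX. f x \<in> N}) euclidean h"
        using W(3) N(3) by (rule continuous_map_from_subtopology_mono)
      show "dist (h x) (g0 x) < \<epsilon> x" if "x \<in> MX" "f x \<in> N" for x using W(4) N(3) that by blast
      show "finite {(h x1, h x2) | x1 x2. x1 \<in> MX \<and> x2 \<in> MX \<and> f x1 \<in> N \<and> f x2 \<in> N \<and> \<delta> \<le> dX x1 x2 \<and>
              h x1 \<noteq> z \<and> h x2 \<noteq> z \<and> collinear {h x1, z, h x2}}" for z
        by (rule finite_subset[OF _ fin[of z]]) (use N(3) in blast)
    qed
    then show ?thesis using N(1,2) by blast
  qed
  then have "\<forall>y\<in>MY. \<exists>N h. openin Y.mtopology N \<and> y \<in> N \<and> local_sol N h" by blast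
  then obtain N h where N: "\<And>y. y \<in> MY \<Longrightarrow> openin Y.mtopology (N y)" "\<And>y. y \<in> MY \<Longrightarrow> y \<in> N y"
      and sol: "\<And>y. y \<in> MY \<Longrightarrow> local_sol (N y) (h y)"
    by metis
  have h: "\<And>y. y \<in> MY \<Longrightarrow> continuous_map (subtopology X.mtopology {x \<in> MX. f x \<in> N y}) euclidean (h y)"
      "\<And>y x. y \<in> MY \<Longrightarrow> x \<in> MX \<Longrightarrow> f x \<in> N y \<Longrightarrow> dist (h y x) (g0 x) < \<epsilon> x"
      "\<And>y z. y \<in> MY \<Longrightarrow> finite {(h y x1, h y x2) | x1 x2. x1 \<in> MX \<and> x2 \<in> MX \<and> f x1 \<in> N y \<and> f x2 \<in> N y \<and> \<delta> \<le> dX x1 x2 \<and>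
              h y x1 \<noteq> z \<and> h y x2 \<noteq> z \<and> collinear {h y x1, z, h y x2}}"
    using sol unfolding local_sol_def by blast+
  obtain \<W> where W: "\<And>W. W \<in> \<W> \<Longrightarrow> openin Y.mtopology W" "pairwise disjnt \<W>" "\<Union>\<W> = MY"
    "\<And>W. W \<in> \<W> \<Longrightarrow> \<exists>y\<in>MY. W \<subseteq> N y"
  proof (rule Y.zero_dim_partition[OF dimY])
    show "openin Y.mtopology (N y)" "y \<in> N y" if "y \<in> MY" for y using N that by blast+
  qed (rule that)
  have "\<forall>W\<in>\<W>. \<exists>y\<in>MY. W \<subseteq> N y" using W(4) by blast
  then obtain c where c: "\<And>W. W \<in> \<W> \<Longrightarrow> c W \<in> MY" "\<And>W. W \<in> \<W> \<Longrightarrow> W \<subseteq> N (c W)" by metis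
  let ?T = "\<lambda>W. {x \<in> MX. f x \<in> W}"
  obtain g where g: "continuous_map X.mtopology euclidean g"
    "\<And>x W. W \<in> \<W> \<Longrightarrow> x \<in> topspace X.mtopology \<inter> ?T W \<Longrightarrow> g x = h (c W) x"
  proof (rule pasting_lemma_exists[where X = X.mtopology and I = \<W> and T = ?T and f = "\<lambda>W. h (c W)" and Y = euclidean])
    show "topspace X.mtopology \<subseteq> (\<Union>W\<in>\<W>. ?T W)" using W(3) f_in by auto
    show "openin X.mtopology (?T W)" if "W \<in> \<W>" for W
      using openin_continuous_map_preimage[OF cont W(1)[OF that]] by simp
    show "continuous_map (subtopology X.mtopology (?T W)) euclidean (h (c W))" if "W \<in> \<W>" for W
      using h(1)[OF c(1)[OF that]] by (rule continuous_map_from_subtopology_mono) (use c(2)[OF that] in auto)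
    show "h (c V) x = h (c W) x" if "V \<in> \<W>" "W \<in> \<W>" "x \<in> topspace X.mtopology \<inter> ?T V \<inter> ?T W" for V W x
    proof -
      have "V = W" using W(2) that unfolding pairwise_def disjnt_iff by blast
      then show ?thesis by simp
    qed
  qed (use that in blast)
  define g' where "g' = restrict g MX"
  have g'eq: "g' x = h (c W) x" if "W \<in> \<W>" "x \<in> MX" "f x \<in> W" for x W
    using g(2)[OF that(1), of x] that by (simp add: g'_def)
  have "continuous_map X.mtopology euclidean g'" using g(1) by (rule continuous_map_eq) (simp add: g'_def)
  then have g'c: "g' \<in> cont_maps X.mtopology" by (simp add: cont_maps_def g'_def)
  show ?thesis
  proof
    have "dist (g' x) (g0 x) < \<epsilon> x" if x: "x \<in> MX" for x
    proof -
      obtain W where V: "W \<in> \<W>" "f x \<in> W" using W(3) f_in[OF x] by blast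
      then show ?thesis using g'eq[OF V(1) x V(2)] h(2)[OF c(1)[OF V(1)] x] c(2)[OF V(1)] by auto
    qed
    then show "g' \<in> sl_ball X.mtopology g0 \<epsilon>" using g'c by (simp add: sl_ball_def)
    show "good_level k g'"
      unfolding good_level_def
    proof (intro ballI allI impI)
      fix y z assume y: "y \<in> MY" and z: "z \<notin> g' ` fib y"
      obtain W where V: "W \<in> \<W>" "y \<in> W" using W(3) y by blast
      have yN: "y \<in> N (c W)" using V c(2) by blast
      have e: "g' x = h (c W) x" "g' x \<noteq> z" if "x \<in> fib y" for x using g'eq[OF V(1)] that V(2) z by auto
      have "pairs k g' y z \<subseteq> {(h (c W) x1, h (c W) x2) | x1 x2. x1 \<in> MX \<and> x2 \<in> MX \<and> f x1 \<in> N (c W) \<and> f x2 \<in> N (c W) \<and> \<delta> \<le> dX x1 x2 \<and>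
              h (c W) x1 \<noteq> z \<and> h (c W) x2 \<noteq> z \<and> collinear {h (c W) x1, z, h (c W) x2}}"
      proof
        fix p assume "p \<in> pairs k g' y z"
        then obtain x1 x2 where x: "p = (g' x1, g' x2)" "x1 \<in> fib y" "x2 \<in> fib y" "\<delta> \<le> dX x1 x2" "collinear {g' x1, z, g' x2}"
          unfolding pairs_def \<delta>_def by blast
        have "h (c W) x1 \<noteq> z" "h (c W) x2 \<noteq> z" using e(1,2)[OF x(2)] e(1,2)[OF x(3)] by auto
        then show "p \<in> {(h (c W) x1, h (c W) x2) | x1 x2. x1 \<in> MX \<and> x2 \<in> MX \<and> f x1 \<in> N (c W) \<and> f x2 \<in> N (c W) \<and> \<delta> \<le> dX x1 x2 \<and>
              h (c W) x1 \<noteq> z \<and> h (c W) x2 \<noteq> z \<and> collinear {h (c W) x1, z, h (c W) x2}}"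
          using x yN e(1)[OF x(2)] e(1)[OF x(3)] by (intro CollectI exI[of _ x1] exI[of _ x2]) auto
      qed
      then have "finite (pairs k g' y z)" using h(3)[OF c(1)[OF V(1)]] finite_subset by blast
      then show "small_pieces (inverse (real (Suc k))) (pairs k g' y z)"
        by (rule finite_imp_small_pieces) simp
    qed
  qed
qed

end

section \<open>The maps of the theorem as a countable intersection of dense open sets\<close>

theorem theorem1p3:
  fixes X :: "'a topology" and Y :: "'b topology" and f :: "'a \<Rightarrow> 'b" and n :: nat
  assumes "metrizable_space X" and "metrizable_space Y"
    and "continuous_map X Y f" and "proper_map X Y f"
    and "map_dim X Y f = ereal (real n)"
    and "covering_dim Y = 0"
    and "CARD('m::finite) \<ge> 2 * n + 1"
  shows "dense_gdelta_in (source_limitation_topology X)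
    {g \<in> cont_maps X :: ('a \<Rightarrow> real^'m) set.
      \<forall>y\<in>topspace Y. \<forall>z. z \<notin> g ` fiber X f y \<longrightarrow>
        covering_dim (top_of_set (D21 (fiber X f y) g z)) \<le> 0}"
    (is "dense_gdelta_in ?L ?S")
proof -
  obtain MX dX where X: "Metric_space MX dX" "X = Metric_space.mtopology MX dX"
    using assms(1) unfolding metrizable_space_def by blast
  obtain MY dY where Y: "Metric_space MY dY" "Y = Metric_space.mtopology MY dY"
    using assms(2) unfolding metrizable_space_def by blast
  interpret perfect_metric_map MX dX MY dY f
    using X Y assms(3,4) by (simp add: perfect_metric_map_def perfect_metric_map_axioms_def)
  have [simp]: "topspace Y = MY" using Y by simp
  have dimY: "covering_dim_at_most Y.mtopology 0"
    using assms(6) Y(2) covering_dim_le_iff[of Y 0] by (simp flip: zero_ereal_def)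
  have dimf: "covering_dim_at_most (subtopology X.mtopology (fib y)) (int n)" if y: "y \<in> MY" for y
  proof -
    have "covering_dim (subtopology X (fiber X f y)) \<le> map_dim X Y f"
      unfolding map_dim_def using y by (intro SUP_upper) simp
    then show ?thesis
      using assms(5) X(2) covering_dim_le_iff[of "subtopology X (fiber X f y)" "int n"] by simp
  qed
  \<comment> \<open>Taking the interior makes \<open>U k\<close> open at once; that it contains
    every map with \<open>good_level k\<close> is the content of the stable neighbourhoods.\<close>
  define U where "U k = ?L interior_of {g. \<forall>y\<in>MY. good_at k g y}" for k
  have opU: "openin ?L (U k)" for k by (simp add: U_def)
  have good_U: "g \<in> U k" if g: "g \<in> cont_maps X" "good_level k g" for g k
  proof -
    obtain \<epsilon> where \<epsilon>: "continuous_map X (top_of_set {0<..1}) \<epsilon>"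
      "\<And>h y. h \<in> sl_ball X g \<epsilon> \<Longrightarrow> y \<in> MY \<Longrightarrow> good_at k h y"
      using stable_neighbourhood[of g k] g X(2) by metis
    have "g \<in> sl_ball X g \<epsilon>" using g(1) \<epsilon>(1) by (auto simp: sl_ball_def continuous_map_unit_iff)
    moreover have "sl_ball X g \<epsilon> \<subseteq> U k"
      unfolding U_def using openin_sl_ball[OF g(1) \<epsilon>(1)] \<epsilon>(2) by (intro interior_of_maximal) auto
    ultimately show ?thesis by blast
  qed
  \<comment> \<open>Maps of the theorem satisfy \<open>good_level k\<close> for all \<open>k\<close>
    and so lie in every \<open>U k\<close>. Conversely, \<open>good_at\<close> at all levels gives
    smallness from some level on, which suffices for dimension at most zero.\<close>
  have S_eq: "?S = (\<Inter>k. U k)"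
  proof
    show "?S \<subseteq> (\<Inter>k. U k)"
    proof
      fix g assume g: "g \<in> ?S"
      have gc: "continuous_map X.mtopology euclidean g" using g X(2) by (simp add: cont_maps_def)
      have "good_level k g" for k
        unfolding good_level_def using g small_pieces_if_dim_D21_le_0[OF gc] X(2) by simp
      then show "g \<in> (\<Inter>k. U k)" using good_U g by blast
    qed
    show "(\<Inter>k. U k) \<subseteq> ?S"
    proof
      fix g assume g: "g \<in> (\<Inter>k. U k)"
      have "U k \<subseteq> cont_maps X" for k using opU openin_subset by fastforce
      then have gX: "g \<in> cont_maps X" using g by blast
      then have gc: "continuous_map X.mtopology euclidean g" using X(2) by (simp add: cont_maps_def)
      have good: "good_at k g y" if "y \<in> MY" for k y
        using g that interior_of_subset[of ?L "{g. \<forall>y\<in>MY. good_at k g y}"] unfolding U_def by blast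
      have "covering_dim (top_of_set (D21 (fib y) g z)) \<le> 0" if "y \<in> MY" "z \<notin> g ` fib y" for y z
        using dim_D21_le_0[OF gc that] eventually_small_pieces[OF gc good[OF that(1)] that] by blast
      then show "g \<in> ?S" using gX X(2) by simp
    qed
  qed
  have dense_U: "U k \<inter> sl_ball X h \<epsilon> \<noteq> {}" if h: "h \<in> cont_maps X" "continuous_map X (top_of_set {0<..1}) \<epsilon>" for k h \<epsilon>
  proof -
    obtain g where "g \<in> sl_ball X h \<epsilon>" "good_level k g"
      using good_level_dense[OF dimY dimf, where 'm = "real^'m", of h \<epsilon> k] h assms(7) X(2) by auto
    then show ?thesis using good_U by (auto simp: sl_ball_def)
  qed
  show ?thesis
    unfolding dense_gdelta_in_def
  proof
    have "?S \<subseteq> topspace ?L" by auto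
    moreover have "(countable intersection_of openin ?L) (\<Inter>k. U k)"
      using opU by (intro countable_intersection_of_Inter) (auto intro: countable_intersection_of_inc)
    ultimately show "gdelta_in ?L ?S" unfolding gdelta_in_alt S_eq by blast
    show "?L closure_of ?S = topspace ?L"
    proof (intro equalityI closure_of_subset_topspace subsetI)
      fix h assume h: "h \<in> topspace ?L"
      show "h \<in> ?L closure_of ?S"
        unfolding in_closure_of
      proof (intro conjI allI impI h)
        fix T assume T: "h \<in> T \<and> openin ?L T"
        then obtain \<epsilon> where \<epsilon>: "continuous_map X (top_of_set {0<..1}) \<epsilon>" "sl_ball X h \<epsilon> \<subseteq> T"
          unfolding openin_source_limitation_topology by blast
        have "(\<Inter>k. U k) \<inter> sl_ball X h \<epsilon> \<noteq> {}"
          using source_limitation_Baire[OF opU dense_U _ \<epsilon>(1)] h by simp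
        then show "\<exists>g. g \<in> ?S \<and> g \<in> T" unfolding S_eq using \<epsilon>(2) by blast
      qed
    qed
  qed
qed

end
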